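(* Let $R$ be a commutative ring and let $X$ be a directed space. The collection of $R$-algebras $R[X]=(R_{i+1}[X])_{i\ge 0}$ (with $R_{i+1}[X]$ in simplicial degree $i$) can be given the structure of a simplicial object in the category $Alg$ of (non-unital) associative $R$-algebras which is Kan (i.e. whose underlying simplicial set satisfies the Kan condition). Furthermore, this simplicial structure restricts, for all $a,b\in X$, to $R[X](a,b)=(R_{i+1}[X](a,b))_{i\ge 0}$, where $R_{i+1}[X](a,b)=e^{i+1}_a R_{i+1}[X] e^{i+1}_b$, and $R[X](a,b)$ with this restricted structure is the free (Kan) simplicial $R$-module on the simplicial set $ST(X)(a,b)$.
   Context: A directed space (d-space) is a topological space $X$ with a set $dX$ of continuous paths $[0,1]\to X$ (the d-paths) containing all constant paths, closed under precomposition with continuous non-decreasing maps $[0,1]\to[0,1]$, and closed under concatenation. $\Delta_n=\{(t_0,\dots,t_n): t_j\ge 0,\ \sum_j t_j=1\}$ is the standard simplex, with face inclusions $\delta_k:\Delta_{n-1}\to\Delta_n$ (insert $0$ at position $k$) and degeneracies $\sigma_k:\Delta_n\to\Delta_{n-1}$, $0\le k<n$, $(t_0,\dots,t_n)\mapsto(t_0,\dots,t_k+t_{k+1},\dots,t_n)$. For $i\ge 1$, an $i$-path in $X$ is a continuous map $p:[0,1]\times\Delta_{i-1}\to X$ such that $p(\cdot,t)$ is a d-path for every $t\in\Delta_{i-1}$. For $a,b\in X$, an $i$-trace from $a$ to $b$ is a class of $i$-paths $p$ with $p(0,t)=a$ and $p(1,t)=b$ for all $t$, modulo reparametrization in the first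 coordinate (the equivalence relation generated by $p\sim p\circ(\varphi\times \mathrm{Id})$ with $\varphi:[0,1]\to[0,1]$ continuous, non-decreasing and surjective). $T_i(X)(a,b)$ is the set of $i$-traces from $a$ to $b$. The maps $d_j(p)=p\circ(\mathrm{Id}\times\delta_j)$ (from $(i+1)$-paths to $i$-paths, $0\le j\le i$) and $s_k(p)=p\circ(\mathrm{Id}\times\sigma_k)$ (from $i$-paths to $(i+1)$-paths, $0\le k\le i-1$) induce maps on traces preserving start and end points, and make $ST(X)(a,b)=(T_{i+1}(X)(a,b))_{i\ge 0}$ a simplicial set. $\mathcal{T}_i(X)$ is the category with objects the points of $X$, morphisms from $a$ to $b$ the $i$-traces from $a$ to $b$, composition given by concatenation in the first coordinate: $(p*q)(s,t)=p(2s,t)$ for $s\le 1/2$ and $q(2s-1,t)$ for $s\ge 1/2$. $R_i[X]$ is the category algebra of $\mathcal{T}_i(X)$: the free $R$-module on all $i$-traces, with bilinear product determined on basis elements by $p\times q=p*q$ if the end point of $p$ is the start point of $q$, and $p\times q=0$ otherwise. $e^i_a\in R_i[X]$ is the constant $i$-trace at $a$. A (non-unital) associative $R$-algebra is an $R$-module with an associative bilinear multiplication; morphisms are $R$-linear maps preserving multiplication. *)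

theory Defs
  imports "HOL-Homology.Simplices" "HOL-Algebra.Module"
begin

section \<open>Directed spaces\<close>

text \<open>
  The space is an abstract topology with underlying set \<open>topspace X\<close>. A path is represented by the
  unique function on the reals that is \<open>extensional\<close> on the unit interval, so that equality of
  functions is equality of paths; hence the uses of \<open>restrict\<close> below.
\<close>

definition monotone_endo :: "(real \<Rightarrow> real) \<Rightarrow> bool" where
  "monotone_endo \<phi> \<longleftrightarrow>
     continuous_on {0..1} \<phi> \<and> mono_on {0..1} \<phi> \<and> \<phi> ` {0..1} \<subseteq> {0..1}"

locale d_space =
  fixes X :: "'a topology" and dX :: "(real \<Rightarrow> 'a) set"
  assumes dpath_extensional: "p \<in> dX \<Longrightarrow> p \<in> extensional {0..1}"
    and dpath_pathin: "p \<in> dX \<Longrightarrow> pathin X p"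
    and dpath_const: "x \<in> topspace X \<Longrightarrow> restrict (\<lambda>_. x) {0..1} \<in> dX"
    and dpath_reparam:
      "p \<in> dX \<Longrightarrow> monotone_endo \<phi> \<Longrightarrow> restrict (\<lambda>s. p (\<phi> s)) {0..1} \<in> dX"
    and dpath_concat:
      "p \<in> dX \<Longrightarrow> q \<in> dX \<Longrightarrow> p 1 = q 0 \<Longrightarrow>
       restrict (\<lambda>s. if s \<le> 1/2 then p (2 * s) else q (2 * s - 1)) {0..1} \<in> dX"


section \<open>Higher paths and traces\<close>

text \<open>
  The index \<open>i\<close> below is always positive. The library's \<open>standard_simplex n\<close> consists of
  sequences vanishing beyond position \<open>n\<close>, and \<open>simplical_face k\<close> inserts a zero at position \<open>k\<close>.
\<close>

definition simplicial_degeneracy :: "nat \<Rightarrow> (nat \<Rightarrow> real) \<Rightarrow> nat \<Rightarrow> real" where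
  "simplicial_degeneracy k t =
     (\<lambda>j. if j < k then t j else if j = k then t k + t (Suc k) else t (Suc j))"

definition ipath_dom :: "nat \<Rightarrow> (real \<times> (nat \<Rightarrow> real)) set" where
  "ipath_dom i = {0..1} \<times> standard_simplex (i - 1)"

type_synonym 'a ipath = "real \<times> (nat \<Rightarrow> real) \<Rightarrow> 'a"

definition ipaths :: "'a topology \<Rightarrow> (real \<Rightarrow> 'a) set \<Rightarrow> nat \<Rightarrow> 'a ipath set" where
  "ipaths X dX i =
     {p \<in> extensional (ipath_dom i).
        continuous_map
          (prod_topology (top_of_set {0..1})
             (subtopology (powertop_real UNIV) (standard_simplex (i - 1)))) X p \<and>
        (\<forall>t \<in> standard_simplex (i - 1). restrict (\<lambda>s. p (s, t)) {0..1} \<in> dX)}"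

definition ipaths_between ::
  "'a topology \<Rightarrow> (real \<Rightarrow> 'a) set \<Rightarrow> nat \<Rightarrow> 'a \<Rightarrow> 'a \<Rightarrow> 'a ipath set" where
  "ipaths_between X dX i a b =
     {p \<in> ipaths X dX i. \<forall>t \<in> standard_simplex (i - 1). p (0, t) = a \<and> p (1, t) = b}"

definition ipath_reparam ::
  "'a topology \<Rightarrow> (real \<Rightarrow> 'a) set \<Rightarrow> nat \<Rightarrow> 'a ipath \<Rightarrow> 'a ipath \<Rightarrow> bool" where
  "ipath_reparam X dX i p q \<longleftrightarrow>
     p \<in> ipaths X dX i \<and>
     (\<exists>\<phi>. monotone_endo \<phi> \<and> \<phi> ` {0..1} = {0..1} \<and>
          q = restrict (\<lambda>(s, t). p (\<phi> s, t)) (ipath_dom i))"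

definition trace_of ::
  "'a topology \<Rightarrow> (real \<Rightarrow> 'a) set \<Rightarrow> nat \<Rightarrow> 'a ipath \<Rightarrow> 'a ipath set" where
  "trace_of X dX i p = {q. equivclp (ipath_reparam X dX i) p q}"

definition traces ::
  "'a topology \<Rightarrow> (real \<Rightarrow> 'a) set \<Rightarrow> nat \<Rightarrow> 'a \<Rightarrow> 'a \<Rightarrow> 'a ipath set set" where
  "traces X dX i a b = trace_of X dX i ` ipaths_between X dX i a b"

definition ipath_concat :: "nat \<Rightarrow> 'a ipath \<Rightarrow> 'a ipath \<Rightarrow> 'a ipath" where
  "ipath_concat i p q =
     restrict (\<lambda>(s, t). if s \<le> 1/2 then p (2 * s, t) else q (2 * s - 1, t)) (ipath_dom i)"

text \<open>
  Operations on traces are induced from operations on representatives: the class of the result does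
  not depend on the representatives, so the unions below are unions of copies of a single class.
\<close>

definition trace_concat ::
  "'a topology \<Rightarrow> (real \<Rightarrow> 'a) set \<Rightarrow> nat \<Rightarrow> 'a ipath set \<Rightarrow> 'a ipath set \<Rightarrow> 'a ipath set" where
  "trace_concat X dX i \<tau> \<tau>' =
     (\<Union>p \<in> \<tau>. \<Union>q \<in> \<tau>'. trace_of X dX i (ipath_concat i p q))"

definition const_trace :: "'a topology \<Rightarrow> (real \<Rightarrow> 'a) set \<Rightarrow> nat \<Rightarrow> 'a \<Rightarrow> 'a ipath set" where
  "const_trace X dX i a = trace_of X dX i (restrict (\<lambda>_. a) (ipath_dom i))"

text \<open>\<open>ipath_face i\<close> maps \<open>(i+1)\<close>-paths to \<open>i\<close>-paths, \<open>ipath_degen i\<close> maps \<open>i\<close>-paths to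
  \<open>(i+1)\<close>-paths.\<close>

definition ipath_face :: "nat \<Rightarrow> nat \<Rightarrow> 'a ipath \<Rightarrow> 'a ipath" where
  "ipath_face i j p = restrict (\<lambda>(s, t). p (s, simplical_face j t)) (ipath_dom i)"

definition ipath_degen :: "nat \<Rightarrow> nat \<Rightarrow> 'a ipath \<Rightarrow> 'a ipath" where
  "ipath_degen i k p =
     restrict (\<lambda>(s, t). p (s, simplicial_degeneracy k t)) (ipath_dom (Suc i))"

definition trace_face ::
  "'a topology \<Rightarrow> (real \<Rightarrow> 'a) set \<Rightarrow> nat \<Rightarrow> nat \<Rightarrow> 'a ipath set \<Rightarrow> 'a ipath set" where
  "trace_face X dX i j \<tau> = (\<Union>p \<in> \<tau>. trace_of X dX i (ipath_face i j p))"

definition trace_degen ::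
  "'a topology \<Rightarrow> (real \<Rightarrow> 'a) set \<Rightarrow> nat \<Rightarrow> nat \<Rightarrow> 'a ipath set \<Rightarrow> 'a ipath set" where
  "trace_degen X dX i k \<tau> = (\<Union>p \<in> \<tau>. trace_of X dX (Suc i) (ipath_degen i k p))"


section \<open>Simplicial sets\<close>

text \<open>\<open>d n j\<close> is the face map from degree \<open>n+1\<close> to degree \<open>n\<close> and \<open>s n k\<close> the degeneracy from
  degree \<open>n\<close> to degree \<open>n+1\<close>.\<close>

locale simplicial_set =
  fixes K :: "nat \<Rightarrow> 'a set"
    and d :: "nat \<Rightarrow> nat \<Rightarrow> 'a \<Rightarrow> 'a"
    and s :: "nat \<Rightarrow> nat \<Rightarrow> 'a \<Rightarrow> 'a"
  assumes face_closed: "j \<le> Suc n \<Longrightarrow> x \<in> K (Suc n) \<Longrightarrow> d n j x \<in> K n"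
    and degen_closed: "k \<le> n \<Longrightarrow> x \<in> K n \<Longrightarrow> s n k x \<in> K (Suc n)"
    and face_face:
      "i < j \<Longrightarrow> j \<le> Suc (Suc n) \<Longrightarrow> x \<in> K (Suc (Suc n)) \<Longrightarrow>
       d n i (d (Suc n) j x) = d n (j - 1) (d (Suc n) i x)"
    and degen_degen:
      "i \<le> j \<Longrightarrow> j \<le> n \<Longrightarrow> x \<in> K n \<Longrightarrow>
       s (Suc n) i (s n j x) = s (Suc n) (Suc j) (s n i x)"
    and face_degen_less:
      "i < j \<Longrightarrow> j \<le> Suc n \<Longrightarrow> x \<in> K (Suc n) \<Longrightarrow>
       d (Suc n) i (s (Suc n) j x) = s n (j - 1) (d n i x)"
    and face_degen_id:
      "i = j \<or> i = Suc j \<Longrightarrow> j \<le> n \<Longrightarrow> x \<in> K n \<Longrightarrow> d n i (s n j x) = x"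
    and face_degen_greater:
      "Suc j < i \<Longrightarrow> i \<le> Suc (Suc n) \<Longrightarrow> x \<in> K (Suc n) \<Longrightarrow>
       d (Suc n) i (s (Suc n) j x) = s n j (d n (i - 1) x)"

text \<open>
  A horn in dimension \<open>n+1\<close> missing the face \<open>k\<close> is a family \<open>y\<close> of \<open>n\<close>-simplices indexed by
  \<open>{..n+1} - {k}\<close>. It has no compatibility condition to satisfy when \<open>n = 0\<close>.
\<close>

definition kan :: "(nat \<Rightarrow> 'a set) \<Rightarrow> (nat \<Rightarrow> nat \<Rightarrow> 'a \<Rightarrow> 'a) \<Rightarrow> bool" where
  "kan K d \<longleftrightarrow>
     (\<forall>n. \<forall>k \<le> Suc n. \<forall>y.
        (\<forall>j \<in> {..Suc n} - {k}. y j \<in> K n) \<and>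
        (\<forall>m i j. n = Suc m \<and> i < j \<and> i \<in> {..Suc n} - {k} \<and> j \<in> {..Suc n} - {k} \<longrightarrow>
           d m i (y j) = d m (j - 1) (y i))
        \<longrightarrow> (\<exists>x \<in> K (Suc n). \<forall>j \<in> {..Suc n} - {k}. d n j x = y j))"


section \<open>Simplicial modules and simplicial algebras\<close>

definition linear_hom ::
  "('r, 'z) ring_scheme \<Rightarrow> ('r, 'm) module \<Rightarrow> ('r, 'n) module \<Rightarrow> ('m \<Rightarrow> 'n) set" where
  "linear_hom R M N =
     {f \<in> carrier M \<rightarrow> carrier N.
        (\<forall>x \<in> carrier M. \<forall>y \<in> carrier M. f (x \<oplus>\<^bsub>M\<^esub> y) = f x \<oplus>\<^bsub>N\<^esub> f y) \<and>
        (\<forall>r \<in> carrier R. \<forall>x \<in> carrier M. f (r \<odot>\<^bsub>M\<^esub> x) = r \<odot>\<^bsub>N\<^esub> f x)}"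

locale simplicial_module = simplicial_set "\<lambda>n. carrier (M n)" D S
  for R :: "('r, 'z) ring_scheme" and M :: "nat \<Rightarrow> ('r, 'm) module" and D S +
  assumes level_module: "Module.module R (M n)"
    and face_linear: "j \<le> Suc n \<Longrightarrow> D n j \<in> linear_hom R (M (Suc n)) (M n)"
    and degen_linear: "k \<le> n \<Longrightarrow> S n k \<in> linear_hom R (M n) (M (Suc n))"

text \<open>
  The library's locale \<open>algebra\<close> is for commutative unital algebras. A non-unital algebra is a
  record of the same type whose field \<open>one\<close> is unused.
\<close>

locale nonunital_algebra = Module.module R A
  for R :: "('r, 'z) ring_scheme" and A :: "('r, 'm) module" +
  assumes mult_closed: "x \<in> carrier A \<Longrightarrow> y \<in> carrier A \<Longrightarrow> x \<otimes>\<^bsub>A\<^esub> y \<in> carrier A"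
    and mult_assoc:
      "x \<in> carrier A \<Longrightarrow> y \<in> carrier A \<Longrightarrow> z \<in> carrier A \<Longrightarrow>
       (x \<otimes>\<^bsub>A\<^esub> y) \<otimes>\<^bsub>A\<^esub> z = x \<otimes>\<^bsub>A\<^esub> (y \<otimes>\<^bsub>A\<^esub> z)"
    and mult_add_left:
      "x \<in> carrier A \<Longrightarrow> y \<in> carrier A \<Longrightarrow> z \<in> carrier A \<Longrightarrow>
       (x \<oplus>\<^bsub>A\<^esub> y) \<otimes>\<^bsub>A\<^esub> z = (x \<otimes>\<^bsub>A\<^esub> z) \<oplus>\<^bsub>A\<^esub> (y \<otimes>\<^bsub>A\<^esub> z)"
    and mult_add_right:
      "x \<in> carrier A \<Longrightarrow> y \<in> carrier A \<Longrightarrow> z \<in> carrier A \<Longrightarrow>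
       x \<otimes>\<^bsub>A\<^esub> (y \<oplus>\<^bsub>A\<^esub> z) = (x \<otimes>\<^bsub>A\<^esub> y) \<oplus>\<^bsub>A\<^esub> (x \<otimes>\<^bsub>A\<^esub> z)"
    and mult_smult_left:
      "r \<in> carrier R \<Longrightarrow> x \<in> carrier A \<Longrightarrow> y \<in> carrier A \<Longrightarrow>
       (r \<odot>\<^bsub>A\<^esub> x) \<otimes>\<^bsub>A\<^esub> y = r \<odot>\<^bsub>A\<^esub> (x \<otimes>\<^bsub>A\<^esub> y)"
    and mult_smult_right:
      "r \<in> carrier R \<Longrightarrow> x \<in> carrier A \<Longrightarrow> y \<in> carrier A \<Longrightarrow>
       x \<otimes>\<^bsub>A\<^esub> (r \<odot>\<^bsub>A\<^esub> y) = r \<odot>\<^bsub>A\<^esub> (x \<otimes>\<^bsub>A\<^esub> y)"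

definition algebra_hom ::
  "('r, 'z) ring_scheme \<Rightarrow> ('r, 'm) module \<Rightarrow> ('r, 'n) module \<Rightarrow> ('m \<Rightarrow> 'n) set" where
  "algebra_hom R A B =
     {f \<in> linear_hom R A B.
        \<forall>x \<in> carrier A. \<forall>y \<in> carrier A. f (x \<otimes>\<^bsub>A\<^esub> y) = f x \<otimes>\<^bsub>B\<^esub> f y}"

locale simplicial_algebra = simplicial_set "\<lambda>n. carrier (A n)" D S
  for R :: "('r, 'z) ring_scheme" and A :: "nat \<Rightarrow> ('r, 'm) module" and D S +
  assumes level_algebra: "nonunital_algebra R (A n)"
    and face_algebra_hom: "j \<le> Suc n \<Longrightarrow> D n j \<in> algebra_hom R (A (Suc n)) (A n)"
    and degen_algebra_hom: "k \<le> n \<Longrightarrow> S n k \<in> algebra_hom R (A n) (A (Suc n))"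


section \<open>Free modules and free simplicial modules\<close>

text \<open>
  The free module on a set \<open>B\<close> consists of the finitely supported functions from \<open>B\<close> to \<open>R\<close>, extended
  by zero outside \<open>B\<close>. The ring fields \<open>mult\<close> and \<open>one\<close> of the record play no role for modules.
\<close>

definition free_module :: "('r, 'z) ring_scheme \<Rightarrow> 'b set \<Rightarrow> ('r, 'b \<Rightarrow> 'r) module" where
  "free_module R B =
     \<lparr>carrier = {f. (\<forall>x \<in> B. f x \<in> carrier R) \<and> (\<forall>x. x \<notin> B \<longrightarrow> f x = \<zero>\<^bsub>R\<^esub>) \<and>
                    finite {x. f x \<noteq> \<zero>\<^bsub>R\<^esub>}},
      mult = undefined, one = undefined,
      zero = (\<lambda>_. \<zero>\<^bsub>R\<^esub>), add = (\<lambda>f g x. f x \<oplus>\<^bsub>R\<^esub> g x),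
      smult = (\<lambda>r f x. r \<otimes>\<^bsub>R\<^esub> f x)\<rparr>"

definition basis_elem :: "('r, 'z) ring_scheme \<Rightarrow> 'b \<Rightarrow> 'b \<Rightarrow> 'r" where
  "basis_elem R x = (\<lambda>y. if y = x then \<one>\<^bsub>R\<^esub> else \<zero>\<^bsub>R\<^esub>)"

definition linear_extension ::
  "('r, 'z) ring_scheme \<Rightarrow> ('b \<Rightarrow> 'c) \<Rightarrow> ('b \<Rightarrow> 'r) \<Rightarrow> 'c \<Rightarrow> 'r" where
  "linear_extension R f u =
     (\<lambda>y. finsum R u {x. u x \<noteq> \<zero>\<^bsub>R\<^esub> \<and> f x = y})"

text \<open>
  The free simplicial module on a simplicial set \<open>(K, d, s)\<close> is the free module on \<open>K n\<close> in degree \<open>n\<close>,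
  with the linear extensions of \<open>d\<close> and \<open>s\<close>. The predicate below says that \<open>(M, D, S)\<close> is free on
  \<open>(K, d, s)\<close> along \<open>\<eta>\<close>, i.e. that it is isomorphic to this model by an isomorphism taking the basis
  element of \<open>x\<close> to \<open>\<eta> n x\<close>.
\<close>

definition simplicial_module_iso ::
  "('r, 'z) ring_scheme \<Rightarrow>
   (nat \<Rightarrow> ('r, 'm) module) \<Rightarrow> (nat \<Rightarrow> nat \<Rightarrow> 'm \<Rightarrow> 'm) \<Rightarrow> (nat \<Rightarrow> nat \<Rightarrow> 'm \<Rightarrow> 'm) \<Rightarrow>
   (nat \<Rightarrow> ('r, 'n) module) \<Rightarrow> (nat \<Rightarrow> nat \<Rightarrow> 'n \<Rightarrow> 'n) \<Rightarrow> (nat \<Rightarrow> nat \<Rightarrow> 'n \<Rightarrow> 'n) \<Rightarrow>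
   (nat \<Rightarrow> 'm \<Rightarrow> 'n) \<Rightarrow> bool" where
  "simplicial_module_iso R M D S N D' S' F \<longleftrightarrow>
     simplicial_module R M D S \<and> simplicial_module R N D' S' \<and>
     (\<forall>n. F n \<in> linear_hom R (M n) (N n) \<and> bij_betw (F n) (carrier (M n)) (carrier (N n))) \<and>
     (\<forall>n. \<forall>j \<le> Suc n. \<forall>x \<in> carrier (M (Suc n)). F n (D n j x) = D' n j (F (Suc n) x)) \<and>
     (\<forall>n. \<forall>k \<le> n. \<forall>x \<in> carrier (M n). F (Suc n) (S n k x) = S' n k (F n x))"

definition is_free_simplicial_module ::
  "('r, 'z) ring_scheme \<Rightarrow>
   (nat \<Rightarrow> ('r, 'm) module) \<Rightarrow> (nat \<Rightarrow> nat \<Rightarrow> 'm \<Rightarrow> 'm) \<Rightarrow> (nat \<Rightarrow> nat \<Rightarrow> 'm \<Rightarrow> 'm) \<Rightarrow>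
   (nat \<Rightarrow> 'b set) \<Rightarrow> (nat \<Rightarrow> nat \<Rightarrow> 'b \<Rightarrow> 'b) \<Rightarrow> (nat \<Rightarrow> nat \<Rightarrow> 'b \<Rightarrow> 'b) \<Rightarrow>
   (nat \<Rightarrow> 'b \<Rightarrow> 'm) \<Rightarrow> bool" where
  "is_free_simplicial_module R M D S K d s \<eta> \<longleftrightarrow>
     simplicial_set K d s \<and>
     (\<exists>F. simplicial_module_iso R
            (\<lambda>n. free_module R (K n))
            (\<lambda>n j. linear_extension R (d n j)) (\<lambda>n k. linear_extension R (s n k))
            M D S F \<and>
          (\<forall>n. \<forall>x \<in> K n. F n (basis_elem R x) = \<eta> n x))"


section \<open>The trace algebras\<close>

text \<open>
  The algebra of a category with objects \<open>Ob\<close>, pairwise disjoint hom-sets \<open>Hom a b\<close> and composition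
  \<open>cmp\<close> in diagrammatic order. The product is the convolution that is \<open>cmp p q\<close> on the basis
  elements of composable \<open>p\<close>, \<open>q\<close> and zero on those of non-composable ones.
\<close>

definition category_algebra ::
  "('r, 'z) ring_scheme \<Rightarrow> 'o set \<Rightarrow> ('o \<Rightarrow> 'o \<Rightarrow> 'b set) \<Rightarrow> ('b \<Rightarrow> 'b \<Rightarrow> 'b) \<Rightarrow>
   ('r, 'b \<Rightarrow> 'r) module" where
  "category_algebra R Ob Hom cmp =
     (free_module R (\<Union>a \<in> Ob. \<Union>b \<in> Ob. Hom a b))
     \<lparr>mult := (\<lambda>f g z.
        finsum R (\<lambda>(p, q). f p \<otimes>\<^bsub>R\<^esub> g q)
          {(p, q). f p \<noteq> \<zero>\<^bsub>R\<^esub> \<and> g q \<noteq> \<zero>\<^bsub>R\<^esub> \<and>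
                   (\<exists>a \<in> Ob. \<exists>b \<in> Ob. \<exists>c \<in> Ob. p \<in> Hom a b \<and> q \<in> Hom b c) \<and>
                   cmp p q = z})\<rparr>"

definition trace_algebra ::
  "('r, 'z) ring_scheme \<Rightarrow> 'a topology \<Rightarrow> (real \<Rightarrow> 'a) set \<Rightarrow> nat \<Rightarrow>
   ('r, 'a ipath set \<Rightarrow> 'r) module" where
  "trace_algebra R X dX i =
     category_algebra R (topspace X) (traces X dX i) (trace_concat X dX i)"

definition corner_module ::
  "('r, 'm) module \<Rightarrow> 'm \<Rightarrow> 'm \<Rightarrow> ('r, 'm) module" where
  "corner_module A e f = A\<lparr>carrier := {(e \<otimes>\<^bsub>A\<^esub> x) \<otimes>\<^bsub>A\<^esub> f | x. x \<in> carrier A}\<rparr>"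

definition trace_module ::
  "('r, 'z) ring_scheme \<Rightarrow> 'a topology \<Rightarrow> (real \<Rightarrow> 'a) set \<Rightarrow> nat \<Rightarrow> 'a \<Rightarrow> 'a \<Rightarrow>
   ('r, 'a ipath set \<Rightarrow> 'r) module" where
  "trace_module R X dX i a b =
     corner_module (trace_algebra R X dX i)
       (basis_elem R (const_trace X dX i a)) (basis_elem R (const_trace X dX i b))"

end

(* On the algebras the structure maps are the linear extensions of the face and degeneracy maps of
   traces. These preserve endpoints and commute with concatenation, so they are identity-on-objects
   functors between the trace categories and induce homomorphisms of category algebras. Cutting down
   by e_a and e_b keeps exactly the basis elements in T(a,b), so the corner is free on the traces from
   a to b. The Kan condition is Moore's theorem that simplicial groups are Kan. *)

theory Submission
  imports Defs
begin

section \<open>Reparametrization, concatenation and pullback of higher paths\<close>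

text \<open>Concatenation of paths is neither associative nor unital, so the analytic work consists
  in exhibiting changes of parameter. A step from \<open>p\<close> to \<open>p\<close> after \<phi>
  is not symmetric, because \<phi> may be constant on intervals: a trace is reached through a chain
  of steps in both directions. Claims are therefore proved for single steps, in the direction in
  which one exists, and then carried along the generated equivalence. Faces and degeneracies act on
  the simplex coordinate only, concatenation and reparametrization on the path coordinate only;
  operations of different kinds thus never interfere. Over a nonzero ring the algebras have no unit
  when \<open>X\<close> is infinite, since the sum of all constant traces is not finitely supported.
  The constant traces are merely local units, and they suffice for the corners. A filler of a horn
  is built with subtraction alone: \<open>S n l\<close> is a section of both \<open>D n l\<close>
  and \<open>D n (Suc l)\<close>, so subtracting a degenerate simplex can repair one of these faces
  at the expense of the other. The order of the repairs has to ensure that the other face is one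
  that does not matter yet, or the missing one.\<close>

abbreviation simplex_top :: "nat \<Rightarrow> (nat \<Rightarrow> real) topology" where
  "simplex_top n \<equiv> subtopology (powertop_real UNIV) (standard_simplex n)"

abbreviation cylinder_top :: "nat \<Rightarrow> (real \<times> (nat \<Rightarrow> real)) topology" where
  "cylinder_top n \<equiv> prod_topology (top_of_set {0..1}) (simplex_top n)"

text \<open>Faces and degeneracies are both precompositions with a map of simplices, so one notion
  serves \<open>ipath_face\<close> and \<open>ipath_degen\<close>.\<close>

abbreviation ipath_pull :: "nat \<Rightarrow> ((nat \<Rightarrow> real) \<Rightarrow> nat \<Rightarrow> real) \<Rightarrow> 'a ipath \<Rightarrow> 'a ipath" where
  "ipath_pull i \<sigma> p \<equiv> restrict (\<lambda>(s, t). p (s, \<sigma> t)) (ipath_dom i)"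

lemma topspace_cylinder: "topspace (cylinder_top n) = ipath_dom (Suc n)"
  by (simp add: ipath_dom_def)

lemma mem_ipath_dom_Suc [simp]:
  "(s, t) \<in> ipath_dom (Suc n) \<longleftrightarrow> 0 \<le> s \<and> s \<le> 1 \<and> t \<in> standard_simplex n"
  by (auto simp: ipath_dom_def)

lemma ipathsD:
  assumes "p \<in> ipaths X dX (Suc n)"
  shows "p \<in> extensional (ipath_dom (Suc n))" "continuous_map (cylinder_top n) X p"
    "\<And>t. t \<in> standard_simplex n \<Longrightarrow> restrict (\<lambda>s. p (s, t)) {0..1} \<in> dX"
  using assms by (auto simp: ipaths_def)

text \<open>Paths are extensional functions; this allows continuity and the d-path condition to be
  checked on the unrestricted formula.\<close>

lemma restrict_ipathI:
  assumes "continuous_map (cylinder_top n) X f"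
    and "\<And>t. t \<in> standard_simplex n \<Longrightarrow> restrict (\<lambda>s. f (s, t)) {0..1} \<in> dX"
  shows "restrict f (ipath_dom (Suc n)) \<in> ipaths X dX (Suc n)"
proof -
  have "continuous_map (cylinder_top n) X (restrict f (ipath_dom (Suc n)))"
    by (rule continuous_map_eq[OF assms(1)]) (auto simp: topspace_cylinder)
  moreover have "restrict (\<lambda>s. restrict f (ipath_dom (Suc n)) (s, t)) {0..1} = restrict (\<lambda>s. f (s, t)) {0..1}"
    if "t \<in> standard_simplex n" for t
    using that by (auto simp: fun_eq_iff)
  ultimately show ?thesis
    using assms(2) by (auto simp: ipaths_def)
qed

lemma ipath_pull_in_ipaths:
  assumes p: "p \<in> ipaths X dX (Suc n)"
    and \<sigma>: "continuous_map (simplex_top m) (simplex_top n) \<sigma>"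
  shows "ipath_pull (Suc m) \<sigma> p \<in> ipaths X dX (Suc m)"
proof (rule restrict_ipathI)
  have "continuous_map (cylinder_top m) (cylinder_top n) (\<lambda>(s, t). (s, \<sigma> t))"
    using \<sigma> by (simp add: case_prod_unfold continuous_map_paired continuous_map_of_fst 
        continuous_map_fst continuous_map_compose[OF continuous_map_snd, unfolded o_def])
  from continuous_map_compose[OF this ipathsD(2)[OF p]]
  show "continuous_map (cylinder_top m) X (\<lambda>(s, t). p (s, \<sigma> t))"
    by (simp add: o_def case_prod_unfold)
  fix t assume "t \<in> standard_simplex m"
  then have "\<sigma> t \<in> standard_simplex n"
    using \<sigma> by (auto simp: continuous_map_def)
  then show "restrict (\<lambda>s. case (s, t) of (s, t) \<Rightarrow> p (s, \<sigma> t)) {0..1} \<in> dX"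
    using ipathsD(3)[OF p] by simp
qed

lemma ipath_pull_pull:
  assumes "\<sigma> \<in> standard_simplex l \<rightarrow> standard_simplex m"
  shows "ipath_pull (Suc l) \<sigma> (ipath_pull (Suc m) \<tau> p) = ipath_pull (Suc l) (\<lambda>t. \<tau> (\<sigma> t)) p"
  using assms by (auto simp: fun_eq_iff restrict_def)

lemma ipath_pull_id:
  assumes "p \<in> ipaths X dX (Suc n)"
  shows "ipath_pull (Suc n) (\<lambda>t. t) p = p"
  using ipathsD(1)[OF assms] by (auto simp: fun_eq_iff restrict_def extensional_def)

section \<open>Changes of parameter and their effect on paths\<close>

abbreviation monotone_surj :: "(real \<Rightarrow> real) \<Rightarrow> bool" where
  "monotone_surj \<phi> \<equiv> monotone_endo \<phi> \<and> \<phi> ` {0..1} = {0..1}"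

lemma monotone_surjD:
  assumes "monotone_surj \<phi>"
  shows "continuous_on {0..1} \<phi>" "\<And>x y. 0 \<le> x \<Longrightarrow> x \<le> y \<Longrightarrow> y \<le> 1 \<Longrightarrow> \<phi> x \<le> \<phi> y"
    "\<And>x. 0 \<le> x \<Longrightarrow> x \<le> 1 \<Longrightarrow> 0 \<le> \<phi> x" "\<And>x. 0 \<le> x \<Longrightarrow> x \<le> 1 \<Longrightarrow> \<phi> x \<le> 1" "\<phi> 0 = 0" "\<phi> 1 = 1"
proof -
  show "continuous_on {0..1} \<phi>" using assms by (simp add: monotone_endo_def)
  show mono: "\<And>x y. 0 \<le> x \<Longrightarrow> x \<le> y \<Longrightarrow> y \<le> 1 \<Longrightarrow> \<phi> x \<le> \<phi> y"
    using assms by (auto simp: monotone_endo_def mono_on_def)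
  show ran: "\<And>x. 0 \<le> x \<Longrightarrow> x \<le> 1 \<Longrightarrow> 0 \<le> \<phi> x" "\<And>x. 0 \<le> x \<Longrightarrow> x \<le> 1 \<Longrightarrow> \<phi> x \<le> 1"
    using assms by (force simp: monotone_endo_def image_subset_iff)+
  have "0 \<in> \<phi> ` {0..1}" "1 \<in> \<phi> ` {0..1}" using assms by auto
  then obtain x y where "x \<in> {0..1}" "\<phi> x = 0" "y \<in> {0..1}" "\<phi> y = 1" by (metis imageE)
  then show "\<phi> 0 = 0" "\<phi> 1 = 1"
    using mono[of 0 x] mono[of y 1] ran[of 0] ran[of 1] by auto
qed

text \<open>For continuous monotone maps surjectivity amounts to fixing 0 and 1, by the intermediate
  value theorem. In this form it can be read off from explicit formulas.\<close>

lemma monotone_surjI: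
  assumes cont: "continuous_on {0..1} \<phi>" and mono: "\<And>x y. 0 \<le> x \<Longrightarrow> x \<le> y \<Longrightarrow> y \<le> 1 \<Longrightarrow> \<phi> x \<le> \<phi> y"
    and "\<phi> 0 = 0" "\<phi> 1 = 1"
  shows "monotone_surj \<phi>"
proof -
  have sub: "\<phi> ` {0..1} \<subseteq> {0..1}"
    using mono[of 0] mono[of _ 1] assms(3,4) by auto
  have "y \<in> \<phi> ` {0..1}" if "y \<in> {0..1}" for y
    using IVT'[of \<phi> 0 y 1] that assms by force
  with sub show ?thesis
    using assms by (auto simp: monotone_endo_def mono_on_def)
qed

lemma ipath_reparam_in_ipaths:
  assumes X: "d_space X dX" and p: "p \<in> ipaths X dX (Suc n)" and \<phi>: "monotone_endo \<phi>"
  shows "restrict (\<lambda>(s, t). p (\<phi> s, t)) (ipath_dom (Suc n)) \<in> ipaths X dX (Suc n)"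
proof (rule restrict_ipathI)
  have ran: "\<phi> s \<in> {0..1}" if "s \<in> {0..1}" for s
    using \<phi> that unfolding monotone_endo_def by blast
  have "continuous_map (top_of_set {0..1}) (top_of_set {0..1}) \<phi>"
    using \<phi> by (auto simp: monotone_endo_def)
  then have "continuous_map (cylinder_top n) (cylinder_top n) (\<lambda>(s, t). (\<phi> s, t))"
    by (simp add: case_prod_unfold continuous_map_paired continuous_map_snd
        continuous_map_compose[OF continuous_map_fst, unfolded o_def])
  from continuous_map_compose[OF this ipathsD(2)[OF p]]
  show "continuous_map (cylinder_top n) X (\<lambda>(s, t). p (\<phi> s, t))"
    by (simp add: o_def case_prod_unfold)
  fix t assume t: "t \<in> standard_simplex n"
  have "restrict (\<lambda>s. restrict (\<lambda>s. p (s, t)) {0..1} (\<phi> s)) {0..1} \<in> dX"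
    by (rule d_space.dpath_reparam[OF X ipathsD(3)[OF p t] \<phi>])
  moreover have "restrict (\<lambda>s. restrict (\<lambda>s. p (s, t)) {0..1} (\<phi> s)) {0..1} = restrict (\<lambda>s. p (\<phi> s, t)) {0..1}"
    using ran by (auto simp: fun_eq_iff)
  ultimately show "restrict (\<lambda>s. case (s, t) of (s, t) \<Rightarrow> p (\<phi> s, t)) {0..1} \<in> dX"
    by simp
qed

lemma const_in_ipaths_between:
  assumes X: "d_space X dX" and "a \<in> topspace X"
  shows "restrict (\<lambda>_. a) (ipath_dom (Suc n)) \<in> ipaths_between X dX (Suc n) a a"
proof -
  have "restrict (\<lambda>_. a) (ipath_dom (Suc n)) \<in> ipaths X dX (Suc n)"
    using assms d_space.dpath_const[OF X] by (intro restrict_ipathI) auto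
  then show ?thesis
    by (auto simp: ipaths_between_def)
qed

text \<open>The simplex is nonempty, so the conditions at the two ends of the cylinder are not
  vacuous and pin down the end points. Disjointness of the hom-sets of traces rests on this.\<close>

lemma ipaths_between_endpoints:
  assumes "p \<in> ipaths_between X dX (Suc n) a b" "p \<in> ipaths_between X dX (Suc n) a' b'"
  shows "a = a'" "b = b'"
  using assms nonempty_standard_simplex[of n] by (auto simp: ipaths_between_def)

lemma ipath_concat_in_between:
  assumes X: "d_space X dX" 
    and p: "p \<in> ipaths_between X dX (Suc n) a b" and q: "q \<in> ipaths_between X dX (Suc n) b c"
  shows "ipath_concat (Suc n) p q \<in> ipaths_between X dX (Suc n) a c"
proof -
  have p': "p \<in> ipaths X dX (Suc n)" and q': "q \<in> ipaths X dX (Suc n)"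
    and pb: "\<And>t. t \<in> standard_simplex n \<Longrightarrow> p (0, t) = a \<and> p (1, t) = b"
    and qb: "\<And>t. t \<in> standard_simplex n \<Longrightarrow> q (0, t) = b \<and> q (1, t) = c"
    using p q by (auto simp: ipaths_between_def)
  have "ipath_concat (Suc n) p q \<in> ipaths X dX (Suc n)"
    unfolding ipath_concat_def
  proof (rule restrict_ipathI)
    let ?C = "cylinder_top n"
    have fs: "continuous_map ?C euclideanreal fst"
      using continuous_map_fst[of "top_of_set {0..1::real}" "simplex_top n"]
      by (simp add: continuous_map_in_subtopology)
    have half1: "continuous_map (subtopology ?C {x \<in> topspace ?C. fst x \<le> 1/2}) ?C (\<lambda>x. (2 * fst x, snd x))"
    proof -
      have "continuous_map (subtopology ?C {x \<in> topspace ?C. fst x \<le> 1/2}) (top_of_set {0..1}) (\<lambda>x. 2 * fst x)"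
        using continuous_map_from_subtopology[OF fs]
        by (auto simp: continuous_map_in_subtopology intro!: continuous_map_real_mult)
      then show ?thesis
        by (simp add: continuous_map_paired continuous_map_from_subtopology continuous_map_snd)
    qed
    have half2: "continuous_map (subtopology ?C {x \<in> topspace ?C. 1/2 \<le> fst x}) ?C (\<lambda>x. (2 * fst x - 1, snd x))"
    proof -
      have "continuous_map (subtopology ?C {x \<in> topspace ?C. 1/2 \<le> fst x}) (top_of_set {0..1}) (\<lambda>x. 2 * fst x - 1)"
        using continuous_map_from_subtopology[OF fs]
        by (auto simp: continuous_map_in_subtopology intro!: continuous_map_real_mult continuous_map_diff)
      then show ?thesis
        by (simp add: continuous_map_paired continuous_map_from_subtopology continuous_map_snd)
    qed
    have "continuous_map ?C X (\<lambda>x. if fst x \<le> 1/2 then p (2 * fst x, snd x) else q (2 * fst x - 1, snd x))"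
    proof (rule continuous_map_cases_le)
      show "continuous_map (subtopology ?C {x \<in> topspace ?C. fst x \<le> 1/2}) X (\<lambda>x. p (2 * fst x, snd x))"
        using continuous_map_compose[OF half1 ipathsD(2)[OF p']] by (simp add: o_def)
      show "continuous_map (subtopology ?C {x \<in> topspace ?C. 1/2 \<le> fst x}) X (\<lambda>x. q (2 * fst x - 1, snd x))"
        using continuous_map_compose[OF half2 ipathsD(2)[OF q']] by (simp add: o_def)
      \<comment> \<open>The two closed halves of the cylinder meet at parameter 1/2, where the
        values are \<open>p (1, t)\<close> and \<open>q (0, t)\<close>; both are
        \<open>b\<close>.\<close>
      show "p (2 * fst x, snd x) = q (2 * fst x - 1, snd x)" if "x \<in> topspace ?C" "fst x = 1/2" for x
      proof -
        have "2 * fst x = 1" "snd x \<in> standard_simplex n" using that by auto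
        then show ?thesis using pb qb by simp
      qed
    qed (use fs in auto)
    then show "continuous_map ?C X (\<lambda>(s, t). if s \<le> 1/2 then p (2 * s, t) else q (2 * s - 1, t))"
      by (simp add: case_prod_unfold)
    fix t assume t: "t \<in> standard_simplex n"
    let ?p = "restrict (\<lambda>s. p (s, t)) {0..1}" and ?q = "restrict (\<lambda>s. q (s, t)) {0..1}"
    have "restrict (\<lambda>s. if s \<le> 1/2 then ?p (2 * s) else ?q (2 * s - 1)) {0..1} \<in> dX"
      using pb[OF t] qb[OF t]
      by (intro d_space.dpath_concat[OF X] ipathsD(3)[OF p' t] ipathsD(3)[OF q' t]) auto
    moreover have "restrict (\<lambda>s. if s \<le> 1/2 then ?p (2 * s) else ?q (2 * s - 1)) {0..1} =
      restrict (\<lambda>s. if s \<le> 1/2 then p (2 * s, t) else q (2 * s - 1, t)) {0..1}"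
      by (auto simp: fun_eq_iff)
    ultimately show "restrict (\<lambda>s. case (s, t) of (s, t) \<Rightarrow> if s \<le> 1/2 then p (2 * s, t) else q (2 * s - 1, t)) {0..1} \<in> dX"
      by simp
  qed
  then show ?thesis
    using pb qb by (auto simp: ipaths_between_def ipath_concat_def)
qed

lemma ipath_pull_in_between:
  assumes p: "p \<in> ipaths_between X dX (Suc n) a b"
    and \<sigma>: "continuous_map (simplex_top m) (simplex_top n) \<sigma>"
  shows "ipath_pull (Suc m) \<sigma> p \<in> ipaths_between X dX (Suc m) a b"
proof -
  have "\<sigma> t \<in> standard_simplex n" if "t \<in> standard_simplex m" for t
    using \<sigma> that by (auto simp: continuous_map_def)
  then show ?thesis
    using p ipath_pull_in_ipaths[OF _ \<sigma>] by (auto simp: ipaths_between_def)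
qed

text \<open>A change of parameter fixes 0 and 1, so end points do not move. An equivalence is needed
  because chains of steps run in both directions.\<close>

lemma ipath_reparam_between:
  assumes X: "d_space X dX" and r: "ipath_reparam X dX (Suc n) p q"
  shows "p \<in> ipaths_between X dX (Suc n) a b \<longleftrightarrow> q \<in> ipaths_between X dX (Suc n) a b"
proof -
  obtain \<phi> where p: "p \<in> ipaths X dX (Suc n)" and \<phi>: "monotone_surj \<phi>"
    and q: "q = restrict (\<lambda>(s, t). p (\<phi> s, t)) (ipath_dom (Suc n))"
    using r by (auto simp: ipath_reparam_def)
  show ?thesis
    using p ipath_reparam_in_ipaths[OF X p, of \<phi>] \<phi>
    by (simp add: ipaths_between_def q monotone_surjD(5,6)[OF \<phi>])
qed

text \<open>The same \<phi> works after pulling back, since it acts on the other coordinate.\<close>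

lemma ipath_reparam_pull:
  assumes r: "ipath_reparam X dX (Suc n) p q"
    and \<sigma>: "continuous_map (simplex_top m) (simplex_top n) \<sigma>"
  shows "ipath_reparam X dX (Suc m) (ipath_pull (Suc m) \<sigma> p) (ipath_pull (Suc m) \<sigma> q)"
proof -
  obtain \<phi> where p: "p \<in> ipaths X dX (Suc n)" and \<phi>: "monotone_surj \<phi>"
    and q: "q = restrict (\<lambda>(s, t). p (\<phi> s, t)) (ipath_dom (Suc n))"
    using r by (auto simp: ipath_reparam_def)
  have "\<sigma> t \<in> standard_simplex n" if "t \<in> standard_simplex m" for t
    using \<sigma> that by (auto simp: continuous_map_def)
  then have "ipath_pull (Suc m) \<sigma> q = restrict (\<lambda>(s, t). ipath_pull (Suc m) \<sigma> p (\<phi> s, t)) (ipath_dom (Suc m))"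
    by (auto simp: q fun_eq_iff restrict_def monotone_surjD(3,4)[OF \<phi>])
  then show ?thesis
    using \<phi> ipath_pull_in_ipaths[OF p \<sigma>] unfolding ipath_reparam_def by blast
qed

text \<open>\<open>ipath_reparam_concat\<close> changes both factors in one step; this lets one of
  them stay fixed.\<close>

lemma ipath_reparam_refl:
  assumes "p \<in> ipaths X dX (Suc n)"
  shows "ipath_reparam X dX (Suc n) p p"
proof -
  have "monotone_surj (\<lambda>s. s)" by (rule monotone_surjI) auto
  moreover have "p = restrict (\<lambda>(s, t). p (s, t)) (ipath_dom (Suc n))"
    using ipathsD(1)[OF assms] by (auto simp: fun_eq_iff restrict_def extensional_def)
  ultimately show ?thesis
    using assms unfolding ipath_reparam_def by blast
qed

lemma ipath_reparamI:
  assumes "p \<in> ipaths_between X dX i a b" "monotone_surj \<phi>"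
    and "\<And>s t. q (s, t) = restrict (\<lambda>(s, t). p (\<phi> s, t)) (ipath_dom i) (s, t)"
  shows "ipath_reparam X dX i p q"
proof -
  have "q = restrict (\<lambda>(s, t). p (\<phi> s, t)) (ipath_dom i)"
    using assms(3) by (auto simp: fun_eq_iff)
  then show ?thesis
    using assms(1,2) unfolding ipath_reparam_def ipaths_between_def by blast
qed

lemma ipath_reparam_concat:
  assumes X: "d_space X dX" 
    and p: "p \<in> ipaths_between X dX (Suc n) a b" and q: "q \<in> ipaths_between X dX (Suc n) b c"
    and pr: "ipath_reparam X dX (Suc n) p p'" and qr: "ipath_reparam X dX (Suc n) q q'"
  shows "ipath_reparam X dX (Suc n) (ipath_concat (Suc n) p q) (ipath_concat (Suc n) p' q')"
proof -
  obtain \<phi> where \<phi>: "monotone_surj \<phi>" and p': "p' = restrict (\<lambda>(s, t). p (\<phi> s, t)) (ipath_dom (Suc n))"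
    using pr by (auto simp: ipath_reparam_def)
  obtain \<psi> where \<psi>: "monotone_surj \<psi>" and q': "q' = restrict (\<lambda>(s, t). q (\<psi> s, t)) (ipath_dom (Suc n))"
    using qr by (auto simp: ipath_reparam_def)
  note \<phi>D = monotone_surjD[OF \<phi>] and \<psi>D = monotone_surjD[OF \<psi>]
  \<comment> \<open>\<theta> runs \<phi> on the first half of the interval and \<psi> on the second,
    each scaled by 1/2; the pieces meet at 1/2 because \<phi> fixes 1 and \<psi> fixes 0.\<close>
  define \<theta> where "\<theta> s = (if s \<le> 1/2 then \<phi> (2 * s) / 2 else 1/2 + \<psi> (2 * s - 1) / 2)" for s
  have half: "2 * s = 1" if "s * 2 = 1" for s :: real using that by simp
  have "continuous_on ({0..1/2} \<union> {1/2..1}) \<theta>"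
    unfolding \<theta>_def
    by (rule continuous_on_If)
      (auto intro!: continuous_intros continuous_on_compose2[OF \<phi>D(1)] continuous_on_compose2[OF \<psi>D(1)] simp: \<phi>D \<psi>D half)
  moreover have "{0..1/2} \<union> {1/2..1} = {0..1::real}" by auto
  ultimately have "continuous_on {0..1} \<theta>" by simp
  moreover have "\<theta> x \<le> \<theta> y" if "0 \<le> x" "x \<le> y" "y \<le> 1" for x y
  proof -
    consider "y \<le> 1/2" | "x \<le> 1/2" "\<not> y \<le> 1/2" | "\<not> x \<le> 1/2" "\<not> y \<le> 1/2" using that by linarith
    then show ?thesis
    proof cases
      case 1 then show ?thesis using that \<phi>D(2)[of "2*x" "2*y"] by (auto simp: \<theta>_def)
    next
      case 2 then show ?thesis using that \<phi>D(4)[of "2*x"] \<psi>D(3)[of "2*y-1"] by (auto simp: \<theta>_def)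
    next
      case 3 then show ?thesis using that \<psi>D(2)[of "2*x-1" "2*y-1"] by (auto simp: \<theta>_def)
    qed
  qed
  ultimately have \<theta>: "monotone_surj \<theta>"
    by (intro monotone_surjI) (auto simp: \<theta>_def \<phi>D \<psi>D)
  have "ipath_concat (Suc n) p' q' (s, t) =
      restrict (\<lambda>(s, t). ipath_concat (Suc n) p q (\<theta> s, t)) (ipath_dom (Suc n)) (s, t)" for s t
  proof (cases "(s, t) \<in> ipath_dom (Suc n)")
    case True
    then have st: "0 \<le> s" "s \<le> 1" "t \<in> standard_simplex n" by auto
    have pq: "p (1, t) = b" "q (0, t) = b" using p q st(3) by (auto simp: ipaths_between_def)
    show ?thesis
    proof (cases "s \<le> 1/2")
      case True
      then show ?thesis
        using st \<phi>D(3)[of "2 * s"] \<phi>D(4)[of "2 * s"] by (simp add: ipath_concat_def p' \<theta>_def)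
    next
      case False
      then have "0 \<le> \<psi> (2 * s-1)" "\<psi> (2 * s-1) \<le> 1" using st \<psi>D(3,4)[of "2 * s-1"] by auto
      \<comment> \<open>If \<psi> is still 0 at \<open>2 * s - 1\<close>, then \<theta> takes the
        value 1/2 and the concatenation is evaluated in its first branch, at
        \<open>p (1, t)\<close>. This equals \<open>q (0, t)\<close> because both are
        \<open>b\<close>.\<close>
      then show ?thesis
        using st pq False by (cases "\<psi> (2 * s-1) = 0") (auto simp: ipath_concat_def q' \<theta>_def)
    qed
  qed (auto simp: ipath_concat_def)
  then show ?thesis
    by (rule ipath_reparamI[OF ipath_concat_in_between[OF X p q] \<theta>])
qed

text \<open>The operations act on different coordinates, so they commute on paths already and no
  change of parameter is required.\<close>

lemma ipath_pull_concat:
  assumes "\<sigma> \<in> standard_simplex m \<rightarrow> standard_simplex n"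
  shows "ipath_pull (Suc m) \<sigma> (ipath_concat (Suc n) p q) =
    ipath_concat (Suc m) (ipath_pull (Suc m) \<sigma> p) (ipath_pull (Suc m) \<sigma> q)"
proof
  fix x show "ipath_pull (Suc m) \<sigma> (ipath_concat (Suc n) p q) x =
    ipath_concat (Suc m) (ipath_pull (Suc m) \<sigma> p) (ipath_pull (Suc m) \<sigma> q) x"
    using assms by (cases x) (auto simp: ipath_concat_def restrict_def)
qed

text \<open>The change of parameter has slopes \<open>1/2\<close>, \<open>1\<close>, \<open>2\<close>, so it is the maximum of its linear pieces.\<close>

lemma ipath_reparam_concat_assoc:
  assumes X: "d_space X dX" 
    and p: "p \<in> ipaths_between X dX (Suc n) a b" and q: "q \<in> ipaths_between X dX (Suc n) b c"
    and r: "r \<in> ipaths_between X dX (Suc n) c d"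
  shows "ipath_reparam X dX (Suc n) (ipath_concat (Suc n) (ipath_concat (Suc n) p q) r)
    (ipath_concat (Suc n) p (ipath_concat (Suc n) q r))"
proof -
  define \<phi> :: "real \<Rightarrow> real" where "\<phi> s = max (s/2) (max (s - 1/4) (2 * s - 1))" for s
  have \<phi>: "monotone_surj \<phi>"
    unfolding \<phi>_def by (rule monotone_surjI) (auto intro!: continuous_intros intro: max.coboundedI1 max.coboundedI2 simp: le_max_iff_disj)
  have "ipath_concat (Suc n) p (ipath_concat (Suc n) q r) (s, t) = restrict (\<lambda>(s, t).
      ipath_concat (Suc n) (ipath_concat (Suc n) p q) r (\<phi> s, t)) (ipath_dom (Suc n)) (s, t)" for s t
  proof (cases "(s, t) \<in> ipath_dom (Suc n)")
    case True
    then have st: "0 \<le> s" "s \<le> 1" "t \<in> standard_simplex n" by auto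
    \<comment> \<open>The break points 1/2 and 3/4 separate \<open>p\<close>, \<open>q\<close> and
      \<open>r\<close> in the right-bracketed path; \<phi> sends them to 1/4 and 1/2, the break
      points of the left-bracketed one.\<close>
    consider "s \<le> 1/2" | "1/2 < s" "s \<le> 3/4" | "3/4 < s" by linarith
    then show ?thesis
    proof cases
      case 1
      then have *: "\<phi> s = s/2" by (auto simp: \<phi>_def)
      show ?thesis using 1 st by (simp add: ipath_concat_def *)
    next
      case 2
      then have *: "\<phi> s = s - 1/4" by (auto simp: \<phi>_def)
      show ?thesis using 2 st by (simp add: ipath_concat_def * algebra_simps)
    next
      case 3
      then have *: "\<phi> s = 2 * s - 1" by (auto simp: \<phi>_def)
      show ?thesis using 3 st by (simp add: ipath_concat_def * algebra_simps)
    qed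
  qed (auto simp: ipath_concat_def)
  then show ?thesis
    by (rule ipath_reparamI[OF ipath_concat_in_between[OF X ipath_concat_in_between[OF X p q] r] \<phi>])
qed

text \<open>Waiting at \<open>a\<close> is produced by a \<phi> that stays at 0 on the first half
  and then runs at double speed. The step starts from \<open>p\<close>: a surjective \<phi> could
  not in general remove the waiting time.\<close>

lemma ipath_reparam_const_left:
  assumes p: "p \<in> ipaths_between X dX (Suc n) a b"
  shows "ipath_reparam X dX (Suc n) p (ipath_concat (Suc n) (restrict (\<lambda>_. a) (ipath_dom (Suc n))) p)"
proof -
  define \<phi> :: "real \<Rightarrow> real" where "\<phi> s = max 0 (2 * s - 1)" for s
  have \<phi>: "monotone_surj \<phi>"
    unfolding \<phi>_def by (rule monotone_surjI) (auto intro!: continuous_intros)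
  have "ipath_concat (Suc n) (restrict (\<lambda>_. a) (ipath_dom (Suc n))) p =
      restrict (\<lambda>(s, t). p (\<phi> s, t)) (ipath_dom (Suc n))"
  proof
    fix x
    show "ipath_concat (Suc n) (restrict (\<lambda>_. a) (ipath_dom (Suc n))) p x =
      restrict (\<lambda>(s, t). p (\<phi> s, t)) (ipath_dom (Suc n)) x"
    proof (cases "fst x \<le> 1/2")
      case True
      then have "\<phi> (fst x) = 0" by (simp add: \<phi>_def)
      then show ?thesis 
        using p True by (cases x) (auto simp: ipath_concat_def ipaths_between_def)
    next
      case False
      then have "\<phi> (fst x) = 2 * fst x - 1" by (simp add: \<phi>_def)
      then show ?thesis 
        using False by (cases x) (auto simp: ipath_concat_def)
    qed
  qed
  then show ?thesis
    using \<phi> p unfolding ipath_reparam_def ipaths_between_def by blast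
qed

lemma ipath_reparam_const_right:
  assumes p: "p \<in> ipaths_between X dX (Suc n) a b"
  shows "ipath_reparam X dX (Suc n) p (ipath_concat (Suc n) p (restrict (\<lambda>_. b) (ipath_dom (Suc n))))"
proof -
  define \<phi> :: "real \<Rightarrow> real" where "\<phi> s = min (2 * s) 1" for s
  have \<phi>: "monotone_surj \<phi>"
    unfolding \<phi>_def by (rule monotone_surjI) (auto intro!: continuous_intros)
  have "ipath_concat (Suc n) p (restrict (\<lambda>_. b) (ipath_dom (Suc n))) =
      restrict (\<lambda>(s, t). p (\<phi> s, t)) (ipath_dom (Suc n))"
    using p by (auto simp: fun_eq_iff ipath_concat_def \<phi>_def restrict_def min_def ipaths_between_def)
  then show ?thesis
    using \<phi> p unfolding ipath_reparam_def ipaths_between_def by blast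
qed

section \<open>Traces\<close>

lemma trace_of_eq_iff: "trace_of X dX i p = trace_of X dX i q \<longleftrightarrow> equivclp (ipath_reparam X dX i) p q"
proof -
  have "equivclp (ipath_reparam X dX i) p q" if "trace_of X dX i p = trace_of X dX i q"
    using that equivclp_refl[of "ipath_reparam X dX i" q] by (auto simp: trace_of_def set_eq_iff)
  moreover have "trace_of X dX i p = trace_of X dX i q" if "equivclp (ipath_reparam X dX i) p q"
    using that unfolding trace_of_def by (blast intro: equivclp_trans equivclp_sym)
  ultimately show ?thesis by blast
qed

lemma trace_of_eqI: "ipath_reparam X dX i p q \<Longrightarrow> trace_of X dX i p = trace_of X dX i q"
  unfolding trace_of_eq_iff by (blast intro: r_into_equivclp)

lemma self_in_trace_of: "p \<in> trace_of X dX i p"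
  by (simp add: trace_of_def)

text \<open>Collapses the unions by which operations on traces are defined, once the class of the
  result is known to be independent of the representative.\<close>

lemma UN_eq_const:
  assumes "x \<in> A" "\<And>x. x \<in> A \<Longrightarrow> f x = c"
  shows "(\<Union>x\<in>A. f x) = c"
  using assms by blast

section \<open>Operations on classes of paths\<close>

lemma trace_of_between:
  assumes X: "d_space X dX" and p: "p \<in> ipaths_between X dX (Suc n) a b" and q: "q \<in> trace_of X dX (Suc n) p"
  shows "q \<in> ipaths_between X dX (Suc n) a b"
proof -
  have "equivclp (ipath_reparam X dX (Suc n)) p q" using q by (simp add: trace_of_def)
  then show ?thesis
    by (induction rule: equivclp_induct) (use p ipath_reparam_between[OF X] in blast)+
qed

text \<open>What respects single steps respects classes. End points are carried through the
  induction because \<open>f\<close>, for instance concatenation with a fixed path, is only required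
  to respect steps between paths from \<open>a\<close> to \<open>b\<close>.\<close>

lemma trace_of_map:
  assumes X: "d_space X dX" and p: "p \<in> ipaths_between X dX (Suc n) a b" and q: "q \<in> trace_of X dX (Suc n) p"
    and f: "\<And>p q. p \<in> ipaths_between X dX (Suc n) a b \<Longrightarrow> q \<in> ipaths_between X dX (Suc n) a b \<Longrightarrow>
      ipath_reparam X dX (Suc n) p q \<Longrightarrow> trace_of X dX i (f p) = trace_of X dX i (f q)"
  shows "trace_of X dX i (f q) = trace_of X dX i (f p)"
proof -
  have "equivclp (ipath_reparam X dX (Suc n)) p q" using q by (simp add: trace_of_def)
  then have "q \<in> ipaths_between X dX (Suc n) a b \<and> trace_of X dX i (f q) = trace_of X dX i (f p)"
  proof (induction rule: equivclp_induct)
    case (step y z)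
    then have "z \<in> ipaths_between X dX (Suc n) a b"
      using ipath_reparam_between[OF X] by blast
    then show ?case using step f by metis
  qed (use p in simp)
  then show ?thesis by simp
qed

text \<open>The representatives are replaced one after the other, first that of \<open>q\<close> and
  then that of \<open>p\<close>: the chains leading to them may differ in length and in the
  directions of their steps.\<close>

lemma trace_concat_trace_of:
  assumes X: "d_space X dX" 
    and p: "p \<in> ipaths_between X dX (Suc n) a b" and q: "q \<in> ipaths_between X dX (Suc n) b c"
  shows "trace_concat X dX (Suc n) (trace_of X dX (Suc n) p) (trace_of X dX (Suc n) q) =
    trace_of X dX (Suc n) (ipath_concat (Suc n) p q)"
proof -
  have "trace_of X dX (Suc n) (ipath_concat (Suc n) p' q') = trace_of X dX (Suc n) (ipath_concat (Suc n) p q)"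
    if p': "p' \<in> trace_of X dX (Suc n) p" and q': "q' \<in> trace_of X dX (Suc n) q" for p' q'
  proof -
    have pm: "p' \<in> ipaths_between X dX (Suc n) a b" 
      using p' trace_of_between[OF X p] by blast
    have "trace_of X dX (Suc n) (ipath_concat (Suc n) p' q') = trace_of X dX (Suc n) (ipath_concat (Suc n) p' q)"
      using pm by (intro trace_of_map[OF X q q'] trace_of_eqI ipath_reparam_concat[OF X pm] ipath_reparam_refl)
        (auto simp: ipaths_between_def)
    also have "\<dots> = trace_of X dX (Suc n) (ipath_concat (Suc n) p q)"
      using q by (intro trace_of_map[OF X p p'] trace_of_eqI ipath_reparam_concat[OF X _ q] ipath_reparam_refl)
        (auto simp: ipaths_between_def)
    finally show ?thesis .
  qed
  then show ?thesis
    unfolding trace_concat_def by (intro UN_eq_const[OF self_in_trace_of])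
qed

definition trace_pull ::
  "'a topology \<Rightarrow> (real \<Rightarrow> 'a) set \<Rightarrow> nat \<Rightarrow> ((nat \<Rightarrow> real) \<Rightarrow> nat \<Rightarrow> real) \<Rightarrow> 'a ipath set \<Rightarrow> 'a ipath set" where
  "trace_pull X dX i \<sigma> \<tau> = (\<Union>p \<in> \<tau>. trace_of X dX i (ipath_pull i \<sigma> p))"

lemma trace_face_eq_pull: "trace_face X dX i j = trace_pull X dX i (simplical_face j)"
  by (simp add: fun_eq_iff trace_face_def trace_pull_def ipath_face_def)

lemma trace_degen_eq_pull: "trace_degen X dX i k = trace_pull X dX (Suc i) (simplicial_degeneracy k)"
  by (simp add: fun_eq_iff trace_degen_def trace_pull_def ipath_degen_def)

lemma trace_pull_trace_of:
  assumes X: "d_space X dX" and p: "p \<in> ipaths_between X dX (Suc n) a b"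
    and \<sigma>: "continuous_map (simplex_top m) (simplex_top n) \<sigma>"
  shows "trace_pull X dX (Suc m) \<sigma> (trace_of X dX (Suc n) p) = trace_of X dX (Suc m) (ipath_pull (Suc m) \<sigma> p)"
proof -
  have "trace_of X dX (Suc m) (ipath_pull (Suc m) \<sigma> q) = trace_of X dX (Suc m) (ipath_pull (Suc m) \<sigma> p)"
    if "q \<in> trace_of X dX (Suc n) p" for q
    by (rule trace_of_map[OF X p that]) (rule trace_of_eqI[OF ipath_reparam_pull[OF _ \<sigma>]])
  then show ?thesis
    unfolding trace_pull_def by (intro UN_eq_const[OF self_in_trace_of])
qed

lemma tracesE:
  assumes "\<tau> \<in> traces X dX i a b"
  obtains p where "p \<in> ipaths_between X dX i a b" "\<tau> = trace_of X dX i p"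
  using assms by (auto simp: traces_def)

lemma trace_pull_in_traces:
  assumes X: "d_space X dX" and \<tau>: "\<tau> \<in> traces X dX (Suc n) a b"
    and \<sigma>: "continuous_map (simplex_top m) (simplex_top n) \<sigma>"
  shows "trace_pull X dX (Suc m) \<sigma> \<tau> \<in> traces X dX (Suc m) a b"
  using \<tau> by (elim tracesE) (auto simp: traces_def trace_pull_trace_of[OF X _ \<sigma>] ipath_pull_in_between[OF _ \<sigma>])

text \<open>Contravariant functoriality in the map of simplices: it reduces each simplicial identity
  for traces to an identity between the maps \<open>simplical_face\<close> and
  \<open>simplicial_degeneracy\<close>.\<close>

lemma trace_pull_pull:
  assumes X: "d_space X dX" and \<tau>: "\<tau> \<in> traces X dX (Suc n) a b"
    and \<sigma>: "continuous_map (simplex_top m) (simplex_top n) \<sigma>" 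
    and \<rho>: "continuous_map (simplex_top l) (simplex_top m) \<rho>"
  shows "trace_pull X dX (Suc l) \<rho> (trace_pull X dX (Suc m) \<sigma> \<tau>) = trace_pull X dX (Suc l) (\<lambda>t. \<sigma> (\<rho> t)) \<tau>"
proof -
  obtain p where p: "p \<in> ipaths_between X dX (Suc n) a b" and \<tau>: "\<tau> = trace_of X dX (Suc n) p"
    using \<tau> by (rule tracesE)
  have "continuous_map (simplex_top l) (simplex_top n) (\<lambda>t. \<sigma> (\<rho> t))"
    using continuous_map_compose[OF \<rho> \<sigma>] by (simp add: o_def)
  moreover have "\<rho> \<in> standard_simplex l \<rightarrow> standard_simplex m"
    using \<rho> by (auto simp: continuous_map_def)
  ultimately show ?thesis
    by (simp only: \<tau> trace_pull_trace_of[OF X p] trace_pull_trace_of[OF X ipath_pull_in_between[OF p \<sigma>] \<rho>]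
        \<sigma> ipath_pull_pull)
qed

lemma trace_pull_id:
  assumes X: "d_space X dX" and \<tau>: "\<tau> \<in> traces X dX (Suc n) a b"
  shows "trace_pull X dX (Suc n) (\<lambda>t. t) \<tau> = \<tau>"
proof -
  obtain p where p: "p \<in> ipaths_between X dX (Suc n) a b" and \<tau>: "\<tau> = trace_of X dX (Suc n) p"
    using \<tau> by (rule tracesE)
  have "ipath_pull (Suc n) (\<lambda>t. t) p = p"
    using p ipath_pull_id by (auto simp: ipaths_between_def)
  moreover have "continuous_map (simplex_top n) (simplex_top n) (\<lambda>t. t)"
    using continuous_map_id[of "simplex_top n"] by (simp add: id_def)
  ultimately show ?thesis
    by (simp add: \<tau> trace_pull_trace_of[OF X p])
qed

lemma trace_pull_concat:
  assumes X: "d_space X dX" and \<tau>: "\<tau> \<in> traces X dX (Suc n) a b" and \<tau>': "\<tau>' \<in> traces X dX (Suc n) b c"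
    and \<sigma>: "continuous_map (simplex_top m) (simplex_top n) \<sigma>"
  shows "trace_pull X dX (Suc m) \<sigma> (trace_concat X dX (Suc n) \<tau> \<tau>') =
    trace_concat X dX (Suc m) (trace_pull X dX (Suc m) \<sigma> \<tau>) (trace_pull X dX (Suc m) \<sigma> \<tau>')"
proof -
  obtain p where p: "p \<in> ipaths_between X dX (Suc n) a b" and \<tau>: "\<tau> = trace_of X dX (Suc n) p"
    using \<tau> by (rule tracesE)
  obtain q where q: "q \<in> ipaths_between X dX (Suc n) b c" and \<tau>': "\<tau>' = trace_of X dX (Suc n) q"
    using \<tau>' by (rule tracesE)
  have "\<sigma> \<in> standard_simplex m \<rightarrow> standard_simplex n"
    using \<sigma> by (auto simp: continuous_map_def)
  then show ?thesis
    by (simp add: \<tau> \<tau>' trace_concat_trace_of[OF X p q] trace_pull_trace_of[OF X _ \<sigma>, OF p] trace_pull_trace_of[OF X _ \<sigma>, OF q] 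
      trace_pull_trace_of[OF X _ \<sigma>, OF ipath_concat_in_between[OF X p q]] ipath_pull_concat
      trace_concat_trace_of[OF X ipath_pull_in_between[OF p \<sigma>] ipath_pull_in_between[OF q \<sigma>]])
qed

section \<open>Free modules\<close>

text \<open>A basis element with a coefficient. Sums of these exhaust the free module, which spares
  the induction below a case for scalar multiples.\<close>

definition monomial :: "('r, 'z) ring_scheme \<Rightarrow> 'r \<Rightarrow> 'b \<Rightarrow> 'b \<Rightarrow> 'r" where
  "monomial R r x = (\<lambda>y. if y = x then r else \<zero>\<^bsub>R\<^esub>)"

lemma basis_elem_eq_monomial: "basis_elem R x = monomial R \<one>\<^bsub>R\<^esub> x"
  by (simp add: basis_elem_def monomial_def)

lemma free_module_simps:
  "f \<in> carrier (free_module R B) \<longleftrightarrow>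
    (\<forall>x \<in> B. f x \<in> carrier R) \<and> (\<forall>x. x \<notin> B \<longrightarrow> f x = \<zero>\<^bsub>R\<^esub>) \<and> finite {x. f x \<noteq> \<zero>\<^bsub>R\<^esub>}"
  "\<zero>\<^bsub>free_module R B\<^esub> = (\<lambda>_. \<zero>\<^bsub>R\<^esub>)"
  "f \<oplus>\<^bsub>free_module R B\<^esub> g = (\<lambda>x. f x \<oplus>\<^bsub>R\<^esub> g x)"
  "r \<odot>\<^bsub>free_module R B\<^esub> f = (\<lambda>x. r \<otimes>\<^bsub>R\<^esub> f x)"
  by (simp_all add: free_module_def)

context cring
begin

lemma free_module_closed: "f \<in> carrier (free_module R B) \<Longrightarrow> f x \<in> carrier R"
  by (cases "x \<in> B") (auto simp: free_module_simps)

lemma free_module_finite: "f \<in> carrier (free_module R B) \<Longrightarrow> finite {x. f x \<noteq> \<zero>}"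
  by (simp add: free_module_simps)

lemma free_module_zero: "(\<lambda>_. \<zero>) \<in> carrier (free_module R B)"
  by (simp add: free_module_simps)

lemma free_module_add:
  assumes "f \<in> carrier (free_module R B)" "g \<in> carrier (free_module R B)"
  shows "(\<lambda>x. f x \<oplus> g x) \<in> carrier (free_module R B)"
proof -
  have "{x. f x \<oplus> g x \<noteq> \<zero>} \<subseteq> {x. f x \<noteq> \<zero>} \<union> {x. g x \<noteq> \<zero>}" by auto
  from finite_subset[OF this] show ?thesis
    using assms by (simp add: free_module_simps)
qed

lemma free_module_smult:
  assumes "f \<in> carrier (free_module R B)" "r \<in> carrier R"
  shows "(\<lambda>x. r \<otimes> f x) \<in> carrier (free_module R B)"
proof -
  have "{x. r \<otimes> f x \<noteq> \<zero>} \<subseteq> {x. f x \<noteq> \<zero>}" using assms(2) by auto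
  from finite_subset[OF this] show ?thesis
    using assms by (simp add: free_module_simps)
qed

lemma monomial_in_free_module:
  assumes "x \<in> B" "r \<in> carrier R"
  shows "monomial R r x \<in> carrier (free_module R B)"
proof -
  have "{y. monomial R r x y \<noteq> \<zero>} \<subseteq> {x}" by (auto simp: monomial_def)
  from finite_subset[OF this] show ?thesis
    using assms by (auto simp: free_module_simps monomial_def)
qed

text \<open>Elements are extended by zero, so a smaller basis yields a subset and not just an
  embedded copy. The corners lie in the full algebra in this sense.\<close>

lemma free_module_mono:
  assumes "B \<subseteq> C" "f \<in> carrier (free_module R B)"
  shows "f \<in> carrier (free_module R C)"
  using assms free_module_closed[OF assms(2)] by (auto simp: free_module_simps)

text \<open>Allows an arbitrary multiplication since \<open>category_algebra\<close> and its corners are free modules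
  with the field \<open>mult\<close> replaced.\<close>

lemma module_free_module: "Module.module R ((free_module R B)\<lparr>mult := m\<rparr>)"
proof (rule moduleI)
  show "cring R" by (rule is_cring)
  show "abelian_group ((free_module R B)\<lparr>mult := m\<rparr>)"
  proof (rule abelian_groupI, goal_cases)
    \<comment> \<open>This goal asks for negatives. Writing them as multiples by the negative of
      \<one> gives membership through \<open>free_module_smult\<close>.\<close>
    case (6 f)
    have "(\<lambda>x. \<ominus> \<one> \<otimes> f x) \<in> carrier (free_module R B)"
      using 6 by (intro free_module_smult) auto
    moreover have "(\<lambda>x. \<ominus> \<one> \<otimes> f x \<oplus> f x) = (\<lambda>_. \<zero>)"
      using 6 free_module_closed[of f B] by (auto simp: fun_eq_iff l_minus l_neg)
    ultimately show ?case
      by (auto simp: free_module_simps intro!: bexI[of _ "\<lambda>x. \<ominus> \<one> \<otimes> f x"])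
  qed (use free_module_closed[of _ B] free_module_add[of _ B] in
      \<open>auto simp: free_module_simps(2-) free_module_zero fun_eq_iff a_ac\<close>)
qed (use free_module_closed[of _ B] free_module_smult[of _ B] in
    \<open>auto simp: free_module_simps(2-) fun_eq_iff l_distr r_distr m_assoc\<close>)

text \<open>Induction on the support, splitting off one coefficient at a time. It plays the role of
  extension by linearity: identities between additive maps need only be checked on
  monomials.\<close>

lemma free_module_induct [consumes 1, case_names zero monomial add]:
  assumes u: "u \<in> carrier (free_module R B)"
    and zero: "P (\<lambda>_. \<zero>)"
    and monomial: "\<And>r x. r \<in> carrier R \<Longrightarrow> x \<in> B \<Longrightarrow> P (monomial R r x)"
    and add: "\<And>u v. u \<in> carrier (free_module R B) \<Longrightarrow> v \<in> carrier (free_module R B) \<Longrightarrow>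
      P u \<Longrightarrow> P v \<Longrightarrow> P (\<lambda>x. u x \<oplus> v x)"
  shows "P u"
proof -
  have "P u" if "finite A" "{x. u x \<noteq> \<zero>} = A" "u \<in> carrier (free_module R B)" for A u
    using that
  proof (induction A arbitrary: u)
    case empty
    then have "u = (\<lambda>_. \<zero>)" by auto
    then show ?case using zero by simp
  next
    case (insert a A)
    define v where "v = u(a := \<zero>)"
    have supp: "{x. v x \<noteq> \<zero>} = A" using insert by (auto simp: v_def)
    have ua: "u a \<in> carrier R" by (rule free_module_closed[OF insert.prems(2)])
    have "a \<in> {x. u x \<noteq> \<zero>}" unfolding insert.prems(1) by simp
    then have a: "a \<in> B" using insert.prems(2) by (auto simp: free_module_simps)
    have v: "v \<in> carrier (free_module R B)"
      using insert.prems(2) insert.hyps(1) supp unfolding free_module_simps by (auto simp: v_def)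
    have "u = (\<lambda>x. monomial R (u a) a x \<oplus> v x)"
      using free_module_closed[OF insert.prems(2)] ua by (auto simp: fun_eq_iff monomial_def v_def)
    then show ?case
      using add[OF monomial_in_free_module[OF a ua] v monomial[OF ua a] insert.IH[OF supp v]] by simp
  qed
  then show ?thesis using u free_module_finite by blast
qed

section \<open>Linear extensions of maps between bases\<close>

text \<open>The defining sum ranges over a set that depends on the support of \<open>u\<close>.
  Summing over any finite superset instead lets the sums for \<open>u\<close>, \<open>v\<close> and
  their sum share one index set.\<close>

lemma linear_extension_eq_finsum:
  assumes u: "u \<in> carrier (free_module R B)" and A: "finite A" "{x. u x \<noteq> \<zero>} \<subseteq> A"
  shows "linear_extension R f u y = (\<Oplus>x\<in>A. if f x = y then u x else \<zero>)"
  unfolding linear_extension_def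
  using A free_module_closed[OF u]
  by (intro add.finprod_mono_neutral_cong_left) auto

lemma linear_extension_closed:
  assumes u: "u \<in> carrier (free_module R B)" and f: "f \<in> B \<rightarrow> C"
  shows "linear_extension R f u \<in> carrier (free_module R C)"
proof -
  \<comment> \<open>Away from the image of the support the sum is empty. This yields both the
    vanishing outside \<open>C\<close> and the finiteness of the support.\<close>
  have 0: "linear_extension R f u y = \<zero>" if "\<nexists>x. u x \<noteq> \<zero> \<and> f x = y" for y
  proof -
    have "{x. u x \<noteq> \<zero> \<and> f x = y} = {}" using that by auto
    then show ?thesis by (simp only: linear_extension_def finsum_empty)
  qed
  have "x \<in> B" if "u x \<noteq> \<zero>" for x using u that by (auto simp: free_module_simps)
  then have "linear_extension R f u y = \<zero>" if "y \<notin> C" for y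
    using that f by (intro 0) auto
  moreover have "linear_extension R f u y \<in> carrier R" for y
    unfolding linear_extension_def using free_module_closed[OF u] by (intro finsum_closed) auto
  moreover have "{y. linear_extension R f u y \<noteq> \<zero>} \<subseteq> f ` {x. u x \<noteq> \<zero>}"
  proof
    fix y assume "y \<in> {y. linear_extension R f u y \<noteq> \<zero>}"
    then show "y \<in> f ` {x. u x \<noteq> \<zero>}" using 0[of y] by auto
  qed
  then have "finite {y. linear_extension R f u y \<noteq> \<zero>}"
    using free_module_finite[OF u] by (metis finite_imageI finite_subset)
  ultimately show ?thesis by (simp add: free_module_simps)
qed

lemma linear_extension_add:
  assumes u: "u \<in> carrier (free_module R B)" and v: "v \<in> carrier (free_module R B)"
  shows "linear_extension R f (\<lambda>x. u x \<oplus> v x) = (\<lambda>y. linear_extension R f u y \<oplus> linear_extension R f v y)"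
proof
  fix y
  let ?A = "{x. u x \<noteq> \<zero>} \<union> {x. v x \<noteq> \<zero>}"
  have A: "finite ?A" using free_module_finite u v by blast
  have "{x. u x \<oplus> v x \<noteq> \<zero>} \<subseteq> ?A" by auto
  then have "linear_extension R f (\<lambda>x. u x \<oplus> v x) y = (\<Oplus>x\<in>?A. if f x = y then u x \<oplus> v x else \<zero>)"
    by (rule linear_extension_eq_finsum[OF free_module_add[OF u v] A])
  also have "\<dots> = (\<Oplus>x\<in>?A. (if f x = y then u x else \<zero>) \<oplus> (if f x = y then v x else \<zero>))"
    using free_module_closed[OF u] free_module_closed[OF v] by (intro finsum_cong') auto
  also have "\<dots> = (\<Oplus>x\<in>?A. if f x = y then u x else \<zero>) \<oplus> (\<Oplus>x\<in>?A. if f x = y then v x else \<zero>)"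
    using free_module_closed[OF u] free_module_closed[OF v] by (intro finsum_addf) auto
  also have "\<dots> = linear_extension R f u y \<oplus> linear_extension R f v y"
    by (simp only: linear_extension_eq_finsum[OF u A Un_upper1] linear_extension_eq_finsum[OF v A Un_upper2])
  finally show "linear_extension R f (\<lambda>x. u x \<oplus> v x) y = linear_extension R f u y \<oplus> linear_extension R f v y" .
qed

lemma linear_extension_smult:
  assumes u: "u \<in> carrier (free_module R B)" and r: "r \<in> carrier R"
  shows "linear_extension R f (\<lambda>x. r \<otimes> u x) = (\<lambda>y. r \<otimes> linear_extension R f u y)"
proof
  fix y
  let ?A = "{x. u x \<noteq> \<zero>}"
  have A: "finite ?A" using free_module_finite u by blast
  have "{x. r \<otimes> u x \<noteq> \<zero>} \<subseteq> ?A" using r by auto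
  then have "linear_extension R f (\<lambda>x. r \<otimes> u x) y = (\<Oplus>x\<in>?A. if f x = y then r \<otimes> u x else \<zero>)"
    by (rule linear_extension_eq_finsum[OF free_module_smult[OF u r] A])
  also have "\<dots> = (\<Oplus>x\<in>?A. r \<otimes> (if f x = y then u x else \<zero>))"
    using free_module_closed[OF u] r by (intro finsum_cong') auto
  also have "\<dots> = r \<otimes> (\<Oplus>x\<in>?A. if f x = y then u x else \<zero>)"
    using free_module_closed[OF u] r A by (intro finsum_rdistr[symmetric]) auto
  also have "\<dots> = r \<otimes> linear_extension R f u y"
    by (simp only: linear_extension_eq_finsum[OF u A subset_refl])
  finally show "linear_extension R f (\<lambda>x. r \<otimes> u x) y = r \<otimes> linear_extension R f u y" .
qed

lemma linear_extension_zero: "linear_extension R f (\<lambda>_. \<zero>) = (\<lambda>_. \<zero>)"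
  by (simp add: linear_extension_def)

lemma linear_extension_monomial:
  assumes "r \<in> carrier R"
  shows "linear_extension R f (monomial R r x) = monomial R r (f x)"
proof
  fix y
  \<comment> \<open>Taking the whole type as the basis avoids a membership hypothesis on
    \<open>x\<close>.\<close>
  have "monomial R r x \<in> carrier (free_module R UNIV)"
    using assms by (intro monomial_in_free_module) auto
  then have "linear_extension R f (monomial R r x) y = (\<Oplus>x'\<in>{x}. if f x' = y then monomial R r x x' else \<zero>)"
    by (rule linear_extension_eq_finsum) (auto simp: monomial_def)
  also have "\<dots> = monomial R r (f x) y"
    using assms by (subst finsum_insert) (auto simp: monomial_def)
  finally show "linear_extension R f (monomial R r x) y = monomial R r (f x) y" .
qed

lemma linear_extension_comp:
  assumes u: "u \<in> carrier (free_module R B)" and f: "f \<in> B \<rightarrow> C"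
  shows "linear_extension R g (linear_extension R f u) = linear_extension R (\<lambda>x. g (f x)) u"
  using u
proof (induction rule: free_module_induct)
  case (add u v)
  then show ?case
    using linear_extension_closed[OF _ f]
    by (simp add: linear_extension_add[of u B v] linear_extension_add[of _ C])
qed (simp_all add: linear_extension_zero linear_extension_monomial)

lemma linear_extension_cong:
  assumes u: "u \<in> carrier (free_module R B)" and "\<And>x. x \<in> B \<Longrightarrow> f x = g x"
  shows "linear_extension R f u = linear_extension R g u"
  using u
proof (induction rule: free_module_induct)
  case (add u v)
  then show ?case by (simp add: linear_extension_add[of u B v])
qed (simp_all add: linear_extension_zero linear_extension_monomial assms(2))

lemma linear_extension_id:
  assumes u: "u \<in> carrier (free_module R B)"
  shows "linear_extension R (\<lambda>x. x) u = u"
  using u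
proof (induction rule: free_module_induct)
  case (add u v)
  then show ?case by (simp add: linear_extension_add[of u B v])
qed (simp_all add: linear_extension_zero linear_extension_monomial)

text \<open>The shape of all simplicial identities except the one whose right side is a bare
  \<open>x\<close>: an equation between two composites on the basis passes to linear extensions,
  even if the composites pass through different intermediate bases.\<close>

lemma linear_extension_comp_cong:
  assumes "u \<in> carrier (free_module R B)" "f \<in> B \<rightarrow> C" "f' \<in> B \<rightarrow> C'"
    and "\<And>x. x \<in> B \<Longrightarrow> g (f x) = g' (f' x)"
  shows "linear_extension R g (linear_extension R f u) = linear_extension R g' (linear_extension R f' u)"
  unfolding linear_extension_comp[OF assms(1,2)] linear_extension_comp[OF assms(1,3)]
  by (rule linear_extension_cong[OF assms(1,4)])

lemma linear_extension_linear_hom: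
  assumes "f \<in> B \<rightarrow> C"
  shows "linear_extension R f \<in> linear_hom R ((free_module R B)\<lparr>mult := m\<rparr>) ((free_module R C)\<lparr>mult := m'\<rparr>)"
  using assms linear_extension_closed[OF _ assms] linear_extension_add[of _ B] linear_extension_smult[of _ B]
  by (auto simp: linear_hom_def free_module_simps(2-))

lemma simplicial_set_linear_extension:
  assumes "simplicial_set K d s"
  shows "simplicial_set (\<lambda>n. carrier (free_module R (K n)))
    (\<lambda>n j. linear_extension R (d n j)) (\<lambda>n k. linear_extension R (s n k))"
proof -
  interpret K: simplicial_set K d s by fact
  have d: "d n j \<in> K (Suc n) \<rightarrow> K n" if "j \<le> Suc n" for n j
    using K.face_closed that by auto
  have s: "s n k \<in> K n \<rightarrow> K (Suc n)" if "k \<le> n" for n k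
    using K.degen_closed that by auto
  show ?thesis
  proof (unfold_locales, goal_cases)
    case 1 then show ?case using d by (blast intro: linear_extension_closed)
  next
    case 2 then show ?case using s by (blast intro: linear_extension_closed)
  next
    case (3 i j n u) then show ?case
      by (intro linear_extension_comp_cong[OF 3(3)] d K.face_face) auto
  next
    case (4 i j n u) then show ?case
      by (intro linear_extension_comp_cong[OF 4(3)] s K.degen_degen) auto
  next
    \<comment> \<open>From degree \<open>n + 1\<close>, one composite passes through degree
      \<open>n + 2\<close> and the other through degree \<open>n\<close>, so both intermediate bases
      are given explicitly.\<close>
    case (5 i j n u) then show ?case
      by (intro linear_extension_comp_cong[OF 5(3), of _ "K (Suc (Suc n))" _ "K n"] d s K.face_degen_less) auto
  next
    case (6 i j n u) 
    then have "linear_extension R (d n i) (linear_extension R (s n j) u) = linear_extension R (\<lambda>x. x) u"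
      unfolding linear_extension_comp[OF 6(3) s[OF 6(2)]]
      by (intro linear_extension_cong[OF 6(3)] K.face_degen_id) auto
    then show ?case using linear_extension_id[OF 6(3)] by simp
  next
    case (7 j i n u) then show ?case
      by (intro linear_extension_comp_cong[OF 7(3), of _ "K (Suc (Suc n))" _ "K n"] d s K.face_degen_greater) auto
  qed
qed

lemma simplicial_module_linear_extension:
  assumes "simplicial_set K d s"
  shows "simplicial_module R (\<lambda>n. (free_module R (K n))\<lparr>mult := m n\<rparr>)
    (\<lambda>n j. linear_extension R (d n j)) (\<lambda>n k. linear_extension R (s n k))"
proof -
  interpret K: simplicial_set K d s by fact
  interpret L: simplicial_set "\<lambda>n. carrier (free_module R (K n))"
    "\<lambda>n j. linear_extension R (d n j)" "\<lambda>n k. linear_extension R (s n k)"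
    by (rule simplicial_set_linear_extension[OF assms])
  have "simplicial_set (\<lambda>n. carrier ((free_module R (K n))\<lparr>mult := m n\<rparr>))
    (\<lambda>n j. linear_extension R (d n j)) (\<lambda>n k. linear_extension R (s n k))"
    using L.simplicial_set_axioms by simp
  then show ?thesis
    by (intro simplicial_module.intro simplicial_module_axioms.intro module_free_module
      linear_extension_linear_hom) (auto intro: K.face_closed K.degen_closed)
qed

end

section \<open>Category algebras\<close>

locale linear_category = cring R for R :: "('r, 'z) ring_scheme" (structure) +
  fixes Ob :: "'o set" and Hom :: "'o \<Rightarrow> 'o \<Rightarrow> 'b set" and cmp :: "'b \<Rightarrow> 'b \<Rightarrow> 'b" and idt :: "'o \<Rightarrow> 'b"
  assumes Hom_disjoint:
      "\<lbrakk>a \<in> Ob; b \<in> Ob; a' \<in> Ob; b' \<in> Ob; p \<in> Hom a b; p \<in> Hom a' b'\<rbrakk> \<Longrightarrow> a = a' \<and> b = b'"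
    and cmp_closed: "\<lbrakk>a \<in> Ob; b \<in> Ob; c \<in> Ob; p \<in> Hom a b; q \<in> Hom b c\<rbrakk> \<Longrightarrow> cmp p q \<in> Hom a c"
    and cmp_assoc: "\<lbrakk>a \<in> Ob; b \<in> Ob; c \<in> Ob; d \<in> Ob; p \<in> Hom a b; q \<in> Hom b c; r \<in> Hom c d\<rbrakk> \<Longrightarrow>
      cmp (cmp p q) r = cmp p (cmp q r)"
    and idt_closed: "a \<in> Ob \<Longrightarrow> idt a \<in> Hom a a"
    and cmp_idt_left: "\<lbrakk>a \<in> Ob; b \<in> Ob; p \<in> Hom a b\<rbrakk> \<Longrightarrow> cmp (idt a) p = p"
    and cmp_idt_right: "\<lbrakk>a \<in> Ob; b \<in> Ob; p \<in> Hom a b\<rbrakk> \<Longrightarrow> cmp p (idt b) = p"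
begin

definition Mor :: "'b set" where "Mor = (\<Union>a \<in> Ob. \<Union>b \<in> Ob. Hom a b)"

definition composable :: "'b \<Rightarrow> 'b \<Rightarrow> bool" where
  "composable p q \<longleftrightarrow> (\<exists>a \<in> Ob. \<exists>b \<in> Ob. \<exists>c \<in> Ob. p \<in> Hom a b \<and> q \<in> Hom b c)"

abbreviation Alg :: "('r, 'b \<Rightarrow> 'r) module" where "Alg \<equiv> category_algebra R Ob Hom cmp"

abbreviation Vec :: "('b \<Rightarrow> 'r) set" where "Vec \<equiv> carrier (free_module R Mor)"

text \<open>The product of \<open>category_algebra\<close> under a name of its own.
  \<open>category_algebra_eq\<close> then presents the algebra as a free module with replaced
  product, the form to which \<open>module_free_module\<close> applies.\<close>

definition conv :: "('b \<Rightarrow> 'r) \<Rightarrow> ('b \<Rightarrow> 'r) \<Rightarrow> 'b \<Rightarrow> 'r" where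
  "conv f g z = finsum R (\<lambda>(p, q). f p \<otimes> g q)
          {(p, q). f p \<noteq> \<zero> \<and> g q \<noteq> \<zero> \<and> composable p q \<and> cmp p q = z}"

lemma category_algebra_eq: "Alg = (free_module R Mor)\<lparr>mult := conv\<rparr>"
  by (simp add: category_algebra_def Mor_def composable_def conv_def[abs_def])

text \<open>Since hom-sets are disjoint, any known end points decide composability. Arguments about
  products can thus split on equality of objects.\<close>

lemma composable_iff:
  assumes "a \<in> Ob" "b \<in> Ob" "b' \<in> Ob" "c \<in> Ob" "p \<in> Hom a b" "q \<in> Hom b' c"
  shows "composable p q \<longleftrightarrow> b = b'"
  using assms Hom_disjoint unfolding composable_def by metis

lemma MorE:
  assumes "p \<in> Mor"
  obtains a b where "a \<in> Ob" "b \<in> Ob" "p \<in> Hom a b"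
  using assms unfolding Mor_def by blast

lemma MorI: "\<lbrakk>a \<in> Ob; b \<in> Ob; p \<in> Hom a b\<rbrakk> \<Longrightarrow> p \<in> Mor"
  unfolding Mor_def by blast

lemma cmp_in_Mor:
  assumes "composable p q"
  shows "cmp p q \<in> Mor"
proof -
  obtain a b c where "a \<in> Ob" "b \<in> Ob" "c \<in> Ob" "p \<in> Hom a b" "q \<in> Hom b c"
    using assms unfolding composable_def by blast
  then show ?thesis by (intro MorI[OF _ _ cmp_closed])
qed

text \<open>The analogue of \<open>linear_extension_eq_finsum\<close>: over a common finite
  rectangle, distributivity becomes a comparison of summands.\<close>

lemma conv_eq_finsum:
  assumes f: "f \<in> Vec" and g: "g \<in> Vec" and A: "finite A" "{x. f x \<noteq> \<zero>} \<subseteq> A"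
    and B: "finite B" "{x. g x \<noteq> \<zero>} \<subseteq> B"
  shows "conv f g z = (\<Oplus>x\<in>A \<times> B. if composable (fst x) (snd x) \<and> cmp (fst x) (snd x) = z
    then f (fst x) \<otimes> g (snd x) else \<zero>)"
  unfolding conv_def
  using A B free_module_closed[OF f] free_module_closed[OF g]
  by (intro add.finprod_mono_neutral_cong_left) auto

lemma conv_closed:
  assumes f: "f \<in> Vec" and g: "g \<in> Vec"
  shows "conv f g \<in> Vec"
proof -
  have 0: "conv f g z = \<zero>" if "\<nexists>p q. f p \<noteq> \<zero> \<and> g q \<noteq> \<zero> \<and> composable p q \<and> cmp p q = z" for z
  proof -
    have "{(p, q). f p \<noteq> \<zero> \<and> g q \<noteq> \<zero> \<and> composable p q \<and> cmp p q = z} = {}" using that by auto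
    then show ?thesis by (simp only: conv_def finsum_empty)
  qed
  have "conv f g z = \<zero>" if "z \<notin> Mor" for z
    using that cmp_in_Mor by (intro 0) blast
  moreover have "conv f g z \<in> carrier R" for z
    unfolding conv_def using free_module_closed[OF f] free_module_closed[OF g] by (intro finsum_closed) auto
  moreover have "{z. conv f g z \<noteq> \<zero>} \<subseteq> (\<lambda>(p, q). cmp p q) ` ({x. f x \<noteq> \<zero>} \<times> {x. g x \<noteq> \<zero>})"
  proof
    fix z assume "z \<in> {z. conv f g z \<noteq> \<zero>}"
    then obtain p q where "f p \<noteq> \<zero>" "g q \<noteq> \<zero>" "cmp p q = z" using 0[of z] by auto
    then show "z \<in> (\<lambda>(p, q). cmp p q) ` ({x. f x \<noteq> \<zero>} \<times> {x. g x \<noteq> \<zero>})" by force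
  qed
  then have "finite {z. conv f g z \<noteq> \<zero>}"
    using free_module_finite[OF f] free_module_finite[OF g] 
    by (metis finite_imageI finite_subset finite_SigmaI)
  ultimately show ?thesis by (auto simp: free_module_simps)
qed

lemma conv_add_left:
  assumes f: "f \<in> Vec" and g: "g \<in> Vec" and h: "h \<in> Vec"
  shows "conv (\<lambda>x. f x \<oplus> g x) h = (\<lambda>z. conv f h z \<oplus> conv g h z)"
proof
  fix z
  let ?A = "{x. f x \<noteq> \<zero>} \<union> {x. g x \<noteq> \<zero>}" and ?B = "{x. h x \<noteq> \<zero>}"
  let ?Q = "\<lambda>x. composable (fst x) (snd x) \<and> cmp (fst x) (snd x) = z"
  note closed = free_module_closed[OF f] free_module_closed[OF g] free_module_closed[OF h]
  have A: "finite ?A" and B: "finite ?B" using free_module_finite f g h by blast+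
  have "{x. f x \<oplus> g x \<noteq> \<zero>} \<subseteq> ?A" by auto
  then have "conv (\<lambda>x. f x \<oplus> g x) h z =
      (\<Oplus>x\<in>?A \<times> ?B. if ?Q x then (f (fst x) \<oplus> g (fst x)) \<otimes> h (snd x) else \<zero>)"
    by (rule conv_eq_finsum[OF free_module_add[OF f g] h A _ B]) simp
  also have "\<dots> = (\<Oplus>x\<in>?A \<times> ?B. (if ?Q x then f (fst x) \<otimes> h (snd x) else \<zero>) \<oplus>
      (if ?Q x then g (fst x) \<otimes> h (snd x) else \<zero>))"
    using closed by (intro finsum_cong') (auto simp: l_distr)
  also have "\<dots> = (\<Oplus>x\<in>?A \<times> ?B. if ?Q x then f (fst x) \<otimes> h (snd x) else \<zero>) \<oplus>
      (\<Oplus>x\<in>?A \<times> ?B. if ?Q x then g (fst x) \<otimes> h (snd x) else \<zero>)"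
    using closed by (intro finsum_addf) auto
  also have "\<dots> = conv f h z \<oplus> conv g h z"
    by (simp only: conv_eq_finsum[OF f h A Un_upper1 B subset_refl] conv_eq_finsum[OF g h A Un_upper2 B subset_refl])
  finally show "conv (\<lambda>x. f x \<oplus> g x) h z = conv f h z \<oplus> conv g h z" .
qed

lemma conv_add_right:
  assumes f: "f \<in> Vec" and g: "g \<in> Vec" and h: "h \<in> Vec"
  shows "conv f (\<lambda>x. g x \<oplus> h x) = (\<lambda>z. conv f g z \<oplus> conv f h z)"
proof
  fix z
  let ?A = "{x. f x \<noteq> \<zero>}" and ?B = "{x. g x \<noteq> \<zero>} \<union> {x. h x \<noteq> \<zero>}"
  let ?Q = "\<lambda>x. composable (fst x) (snd x) \<and> cmp (fst x) (snd x) = z"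
  note closed = free_module_closed[OF f] free_module_closed[OF g] free_module_closed[OF h]
  have A: "finite ?A" and B: "finite ?B" using free_module_finite f g h by blast+
  have "{x. g x \<oplus> h x \<noteq> \<zero>} \<subseteq> ?B" by auto
  then have "conv f (\<lambda>x. g x \<oplus> h x) z =
      (\<Oplus>x\<in>?A \<times> ?B. if ?Q x then f (fst x) \<otimes> (g (snd x) \<oplus> h (snd x)) else \<zero>)"
    by (intro conv_eq_finsum[OF f free_module_add[OF g h] A _ B]) auto
  also have "\<dots> = (\<Oplus>x\<in>?A \<times> ?B. (if ?Q x then f (fst x) \<otimes> g (snd x) else \<zero>) \<oplus>
      (if ?Q x then f (fst x) \<otimes> h (snd x) else \<zero>))"
    using closed by (intro finsum_cong') (auto simp: r_distr)
  also have "\<dots> = (\<Oplus>x\<in>?A \<times> ?B. if ?Q x then f (fst x) \<otimes> g (snd x) else \<zero>) \<oplus>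
      (\<Oplus>x\<in>?A \<times> ?B. if ?Q x then f (fst x) \<otimes> h (snd x) else \<zero>)"
    using closed by (intro finsum_addf) auto
  also have "\<dots> = conv f g z \<oplus> conv f h z"
    by (simp only: conv_eq_finsum[OF f g A subset_refl B Un_upper1] conv_eq_finsum[OF f h A subset_refl B Un_upper2])
  finally show "conv f (\<lambda>x. g x \<oplus> h x) z = conv f g z \<oplus> conv f h z" .
qed

lemma conv_smult:
  assumes f: "f \<in> Vec" and g: "g \<in> Vec" and r: "r \<in> carrier R"
  shows "conv (\<lambda>x. r \<otimes> f x) g = (\<lambda>z. r \<otimes> conv f g z)"
    and "conv f (\<lambda>x. r \<otimes> g x) = (\<lambda>z. r \<otimes> conv f g z)"
proof -
  let ?A = "{x. f x \<noteq> \<zero>}" and ?B = "{x. g x \<noteq> \<zero>}"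
  let ?Q = "\<lambda>z x. composable (fst x) (snd x) \<and> cmp (fst x) (snd x) = z"
  note closed = free_module_closed[OF f] free_module_closed[OF g]
  have A: "finite ?A" and B: "finite ?B" using free_module_finite f g by blast+
  have eq: "r \<otimes> conv f g z = (\<Oplus>x\<in>?A \<times> ?B. if ?Q z x then r \<otimes> (f (fst x) \<otimes> g (snd x)) else \<zero>)" for z
  proof -
    have "r \<otimes> conv f g z = r \<otimes> (\<Oplus>x\<in>?A \<times> ?B. if ?Q z x then f (fst x) \<otimes> g (snd x) else \<zero>)"
      by (simp only: conv_eq_finsum[OF f g A subset_refl B subset_refl])
    also have "\<dots> = (\<Oplus>x\<in>?A \<times> ?B. r \<otimes> (if ?Q z x then f (fst x) \<otimes> g (snd x) else \<zero>))"
      using A B closed r by (intro finsum_rdistr) auto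
    also have "\<dots> = (\<Oplus>x\<in>?A \<times> ?B. if ?Q z x then r \<otimes> (f (fst x) \<otimes> g (snd x)) else \<zero>)"
      using closed r by (intro finsum_cong') auto
    finally show ?thesis .
  qed
  show "conv (\<lambda>x. r \<otimes> f x) g = (\<lambda>z. r \<otimes> conv f g z)"
  proof
    fix z
    have "{x. r \<otimes> f x \<noteq> \<zero>} \<subseteq> ?A" using r by auto
    then have "conv (\<lambda>x. r \<otimes> f x) g z =
        (\<Oplus>x\<in>?A \<times> ?B. if ?Q z x then (r \<otimes> f (fst x)) \<otimes> g (snd x) else \<zero>)"
      by (rule conv_eq_finsum[OF free_module_smult[OF f r] g A _ B]) simp
    also have "\<dots> = r \<otimes> conv f g z"
      unfolding eq using closed r by (intro finsum_cong') (auto simp: m_assoc)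
    finally show "conv (\<lambda>x. r \<otimes> f x) g z = r \<otimes> conv f g z" .
  qed
  show "conv f (\<lambda>x. r \<otimes> g x) = (\<lambda>z. r \<otimes> conv f g z)"
  proof
    fix z
    have "{x. r \<otimes> g x \<noteq> \<zero>} \<subseteq> ?B" using r by auto
    then have "conv f (\<lambda>x. r \<otimes> g x) z =
        (\<Oplus>x\<in>?A \<times> ?B. if ?Q z x then f (fst x) \<otimes> (r \<otimes> g (snd x)) else \<zero>)"
      by (intro conv_eq_finsum[OF f free_module_smult[OF g r] A _ B]) auto
    also have "\<dots> = r \<otimes> conv f g z"
      \<comment> \<open>Commutativity of \<open>R\<close> moves the scalar past the coefficient of
        \<open>f\<close>.\<close>
      unfolding eq using closed r by (intro finsum_cong') (auto simp: m_lcomm)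
    finally show "conv f (\<lambda>x. r \<otimes> g x) z = r \<otimes> conv f g z" .
  qed
qed

lemma conv_zero: "conv (\<lambda>_. \<zero>) g = (\<lambda>_. \<zero>)" "conv f (\<lambda>_. \<zero>) = (\<lambda>_. \<zero>)"
  by (simp_all add: conv_def fun_eq_iff)

lemma conv_monomial:
  assumes p: "p \<in> Mor" and q: "q \<in> Mor" and r: "r \<in> carrier R" and s: "s \<in> carrier R"
  shows "conv (monomial R r p) (monomial R s q) =
    (if composable p q then monomial R (r \<otimes> s) (cmp p q) else (\<lambda>_. \<zero>))"
proof
  fix z
  have "conv (monomial R r p) (monomial R s q) z = (\<Oplus>x\<in>{p} \<times> {q}.
      if composable (fst x) (snd x) \<and> cmp (fst x) (snd x) = z
      then monomial R r p (fst x) \<otimes> monomial R s q (snd x) else \<zero>)"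
    by (rule conv_eq_finsum[OF monomial_in_free_module[OF p r] monomial_in_free_module[OF q s]])
      (auto simp: monomial_def)
  also have "\<dots> = (if composable p q \<and> cmp p q = z then r \<otimes> s else \<zero>)"
  proof -
    have "{p} \<times> {q} = {(p, q)}" by auto
    then show ?thesis using r s by (simp add: monomial_def)
  qed
  finally show "conv (monomial R r p) (monomial R s q) z =
    (if composable p q then monomial R (r \<otimes> s) (cmp p q) else (\<lambda>_. \<zero>)) z"
    by (auto simp: monomial_def)
qed

text \<open>Both sides are additive in each argument, so three nested inductions leave only
  monomials. There the inner end points decide: if both pairs match, associativity of
  \<open>cmp\<close> applies, and otherwise both sides vanish. With a single matching pair, one side
  multiplies a composite by a morphism that does not meet it.\<close>

lemma conv_assoc:
  assumes f: "f \<in> Vec" and g: "g \<in> Vec" and h: "h \<in> Vec"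
  shows "conv (conv f g) h = conv f (conv g h)"
  using f
proof (induction rule: free_module_induct)
  case f: (monomial r p)
  show ?case
    using g
  proof (induction rule: free_module_induct)
    case g: (monomial s q)
    show ?case
      using h
    proof (induction rule: free_module_induct)
      case h: (monomial t w)
      obtain a b where p: "a \<in> Ob" "b \<in> Ob" "p \<in> Hom a b" using f by (elim MorE)
      obtain c d where q: "c \<in> Ob" "d \<in> Ob" "q \<in> Hom c d" using g by (elim MorE)
      obtain k l where w: "k \<in> Ob" "l \<in> Ob" "w \<in> Hom k l" using h by (elim MorE)
      have pq: "composable p q \<longleftrightarrow> b = c" and qw: "composable q w \<longleftrightarrow> d = k"
        by (simp_all add: composable_iff[OF p(1,2) q(1,2) p(3) q(3)] composable_iff[OF q(1,2) w(1,2) q(3) w(3)])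
      show ?case
      proof (cases "b = c"; cases "d = k")
        assume bd: "b = c" "d = k"
        have "cmp p q \<in> Hom a d" "cmp q w \<in> Hom c l"
          using cmp_closed p q w bd by simp_all
        then have "composable (cmp p q) w" "composable p (cmp q w)"
          using composable_iff[of a d k l "cmp p q" w] composable_iff[of a b c l p "cmp q w"] p q w bd by simp_all
        moreover have "cmp (cmp p q) w = cmp p (cmp q w)"
          using cmp_assoc p q w bd by simp
        ultimately show ?thesis
          using f g h pq qw bd by (simp add: conv_monomial cmp_in_Mor m_assoc)
      next
        assume bd: "b = c" "d \<noteq> k"
        have "cmp p q \<in> Hom a d"
          using cmp_closed p q bd by simp
        then have "\<not> composable (cmp p q) w"
          using composable_iff[of a d k l "cmp p q" w] p q w bd by simp
        then show ?thesis
          using f g h pq qw bd by (simp add: conv_monomial conv_zero cmp_in_Mor)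
      next
        assume bd: "b \<noteq> c" "d = k"
        have "cmp q w \<in> Hom c l"
          using cmp_closed q w bd by simp
        then have "\<not> composable p (cmp q w)"
          using composable_iff[of a b c l p "cmp q w"] p q w bd by simp
        then show ?thesis
          using f g h pq qw bd by (simp add: conv_monomial conv_zero cmp_in_Mor)
      next
        assume bd: "b \<noteq> c" "d \<noteq> k"
        then show ?thesis
          using f g h pq qw by (simp add: conv_monomial conv_zero)
      qed
    next
      case (add u v)
      then show ?case
        using f g by (simp add: conv_add_right conv_closed monomial_in_free_module)
    qed (simp add: conv_zero)
  next
    case (add u v)
    then show ?case
      using f h by (simp add: conv_add_left conv_add_right conv_closed monomial_in_free_module)
  qed (simp add: conv_zero)
next
  case (add u v)
  then show ?case
    using g h by (simp add: conv_add_left conv_closed)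
qed (simp add: conv_zero)

lemma nonunital_algebra_category_algebra: "nonunital_algebra R Alg"
  unfolding category_algebra_eq
  by (intro nonunital_algebra.intro nonunital_algebra_axioms.intro module_free_module)
    (simp_all add: conv_closed conv_assoc conv_add_left conv_add_right conv_smult free_module_simps(2-))

section \<open>Corners cut out by identities\<close>

lemma conv_idt_left:
  assumes "a \<in> Ob" "r \<in> carrier R" "c \<in> Ob" "d \<in> Ob" "p \<in> Hom c d"
  shows "conv (basis_elem R (idt a)) (monomial R r p) = (if c = a then monomial R r p else (\<lambda>_. \<zero>))"
proof -
  have "idt a \<in> Mor" "p \<in> Mor" using assms idt_closed MorI by blast+
  then show ?thesis
    using assms composable_iff[OF assms(1,1,3,4) idt_closed assms(5)] cmp_idt_left
    by (auto simp: basis_elem_eq_monomial conv_monomial)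
qed

lemma conv_idt_right:
  assumes "a \<in> Ob" "r \<in> carrier R" "c \<in> Ob" "d \<in> Ob" "p \<in> Hom c d"
  shows "conv (monomial R r p) (basis_elem R (idt a)) = (if d = a then monomial R r p else (\<lambda>_. \<zero>))"
proof -
  have "idt a \<in> Mor" "p \<in> Mor" using assms idt_closed MorI by blast+
  then show ?thesis
    using assms composable_iff[OF assms(3,4,1,1) assms(5) idt_closed] cmp_idt_right
    by (auto simp: basis_elem_eq_monomial conv_monomial)
qed

lemma basis_elem_idt: "a \<in> Ob \<Longrightarrow> basis_elem R (idt a) \<in> Vec"
  unfolding basis_elem_eq_monomial using idt_closed MorI by (intro monomial_in_free_module) auto

text \<open>The map \<open>?e\<close> is a projection: its values lie in the free module on
  \<open>Hom a b\<close>, on which it is the identity. Both facts are checked on monomials. This is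
  an equation of records, and a corner inherits the product of the surrounding algebra; hence
  \<open>conv\<close> on the right.\<close>

lemma corner_category_algebra:
  assumes a: "a \<in> Ob" and b: "b \<in> Ob"
  shows "corner_module Alg (basis_elem R (idt a)) (basis_elem R (idt b)) =
    (free_module R (Hom a b))\<lparr>mult := conv\<rparr>"
proof -
  let ?e = "\<lambda>x. conv (conv (basis_elem R (idt a)) x) (basis_elem R (idt b))"
  note ab = basis_elem_idt[OF a] basis_elem_idt[OF b]
  have e_add: "?e (\<lambda>x. u x \<oplus> v x) = (\<lambda>x. ?e u x \<oplus> ?e v x)" if "u \<in> Vec" "v \<in> Vec" for u v
    using that ab by (simp add: conv_add_left conv_add_right conv_closed)
  have mono: "?e (monomial R r p) = (if c = a \<and> d = b then monomial R r p else (\<lambda>_. \<zero>))"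
    if "r \<in> carrier R" "c \<in> Ob" "d \<in> Ob" "p \<in> Hom c d" for r p c d
    using that a b by (simp add: conv_idt_left[OF a that] conv_idt_right[OF b that] conv_zero)
  have "?e x \<in> carrier (free_module R (Hom a b))" if "x \<in> Vec" for x
    using that
  proof (induction rule: free_module_induct)
    case zero
    show ?case by (simp add: conv_zero free_module_zero)
  next
    case (monomial r p)
    then obtain c d where "c \<in> Ob" "d \<in> Ob" "p \<in> Hom c d" by (elim MorE)
    then show ?case
      using monomial(1) mono monomial_in_free_module free_module_zero by auto
  next
    case (add u v)
    then show ?case using e_add free_module_add by simp
  qed
  moreover have "?e x = x" if "x \<in> carrier (free_module R (Hom a b))" for x
    using that
  proof (induction rule: free_module_induct)
    case zero
    show ?case by (simp add: conv_zero)
  next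
    case (monomial r p)
    then show ?case using mono a b by simp
  next
    case (add u v)
    have "u \<in> Vec" "v \<in> Vec" using add(1,2) a b MorI free_module_mono[of "Hom a b" Mor] by blast+
    then show ?case using add(3,4) e_add by simp
  qed
  moreover have "x \<in> Vec" if "x \<in> carrier (free_module R (Hom a b))" for x
    using that a b MorI free_module_mono[of "Hom a b" Mor] by blast
  ultimately have "{?e x |x. x \<in> Vec} = carrier (free_module R (Hom a b))"
    by (auto, metis)
  then show ?thesis
    unfolding category_algebra_eq by (simp add: corner_module_def free_module_def)
qed

end

text \<open>A functor that identifies objects can make non-composable morphisms composable and turn
  a zero product into a nonzero one. Here \<open>F\<close> keeps end points, so composability is
  preserved in both directions.\<close>

lemma linear_extension_algebra_hom:
  assumes A: "linear_category R Ob Hom cmp idt" and B: "linear_category R Ob Hom' cmp' idt'"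
    and F: "\<And>a b p. \<lbrakk>a \<in> Ob; b \<in> Ob; p \<in> Hom a b\<rbrakk> \<Longrightarrow> F p \<in> Hom' a b"
    and cmp: "\<And>a b c p q. \<lbrakk>a \<in> Ob; b \<in> Ob; c \<in> Ob; p \<in> Hom a b; q \<in> Hom b c\<rbrakk> \<Longrightarrow>
      F (cmp p q) = cmp' (F p) (F q)"
  shows "linear_extension R F \<in> algebra_hom R (category_algebra R Ob Hom cmp) (category_algebra R Ob Hom' cmp')"
proof -
  interpret A: linear_category R Ob Hom cmp idt by fact
  interpret B: linear_category R Ob Hom' cmp' idt' by fact
  let ?L = "linear_extension R F"
  have FM: "F \<in> A.Mor \<rightarrow> B.Mor" using F unfolding A.Mor_def B.Mor_def by blast
  note closed = A.linear_extension_closed[OF _ FM]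
  have "?L (A.conv f g) = B.conv (?L f) (?L g)" if f: "f \<in> A.Vec" and g: "g \<in> A.Vec" for f g
    using f
  proof (induction rule: A.free_module_induct)
    case f: (monomial r p)
    show ?case
      using g
    proof (induction rule: A.free_module_induct)
      case g: (monomial s q)
      obtain a b where p: "a \<in> Ob" "b \<in> Ob" "p \<in> Hom a b" using f by (elim A.MorE)
      obtain c d where q: "c \<in> Ob" "d \<in> Ob" "q \<in> Hom c d" using g by (elim A.MorE)
      have "A.composable p q \<longleftrightarrow> b = c" "B.composable (F p) (F q) \<longleftrightarrow> b = c"
        using A.composable_iff[OF p(1,2) q(1,2) p(3) q(3)] B.composable_iff[OF p(1,2) q(1,2) F[OF p] F[OF q]] by simp_all
      moreover have "F p \<in> B.Mor" "F q \<in> B.Mor" using FM f g by auto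
      moreover have "b = c \<Longrightarrow> F (cmp p q) = cmp' (F p) (F q)" using cmp p q by simp
      ultimately show ?case
        using f g by (simp add: A.conv_monomial B.conv_monomial A.linear_extension_monomial
          A.linear_extension_zero)
    next
      case (add u v)
      then show ?case
        using A.monomial_in_free_module[OF f(2,1)] closed
        by (simp add: A.conv_add_right B.conv_add_right A.linear_extension_add[of _ A.Mor] A.conv_closed
         )
    qed (simp add: A.conv_zero B.conv_zero A.linear_extension_zero)
  next
    case (add u v)
    then show ?case
      using g closed
      by (simp add: A.conv_add_left B.conv_add_left A.linear_extension_add[of _ A.Mor] A.conv_closed)
  qed (simp add: A.conv_zero B.conv_zero A.linear_extension_zero)
  then show ?thesis
    unfolding A.category_algebra_eq B.category_algebra_eq
    using A.linear_extension_linear_hom[OF FM] by (auto simp: algebra_hom_def)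
qed

section \<open>Simplicial modules are Kan\<close>

lemma linear_hom_add:
  "f \<in> linear_hom R M N \<Longrightarrow> x \<in> carrier M \<Longrightarrow> y \<in> carrier M \<Longrightarrow> f (x \<oplus>\<^bsub>M\<^esub> y) = f x \<oplus>\<^bsub>N\<^esub> f y"
  by (simp add: linear_hom_def)

lemma linear_hom_closed: "f \<in> linear_hom R M N \<Longrightarrow> x \<in> carrier M \<Longrightarrow> f x \<in> carrier N"
  by (auto simp: linear_hom_def)

lemma linear_hom_minus:
  assumes "abelian_group M" "abelian_group N" and f: "f \<in> linear_hom R M N" 
    and x: "x \<in> carrier M" and y: "y \<in> carrier M"
  shows "f (x \<ominus>\<^bsub>M\<^esub> y) = f x \<ominus>\<^bsub>N\<^esub> f y"
proof -
  interpret M: abelian_group M by fact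
  interpret N: abelian_group N by fact
  have "f (x \<ominus>\<^bsub>M\<^esub> y) \<oplus>\<^bsub>N\<^esub> f y = f x"
    using linear_hom_add[OF f, of "x \<ominus>\<^bsub>M\<^esub> y" y] x y by (simp add: M.minus_eq M.a_assoc M.l_neg)
  then have "f x \<ominus>\<^bsub>N\<^esub> f y = (f (x \<ominus>\<^bsub>M\<^esub> y) \<oplus>\<^bsub>N\<^esub> f y) \<ominus>\<^bsub>N\<^esub> f y"
    by (simp only:)
  also have "\<dots> = f (x \<ominus>\<^bsub>M\<^esub> y)"
    using linear_hom_closed[OF f x] linear_hom_closed[OF f y] linear_hom_closed[OF f M.minus_closed[OF x y]]
    by (simp add: N.minus_eq N.a_assoc N.r_neg)
  finally show ?thesis by (rule sym)
qed

lemma linear_hom_zero: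
  assumes "abelian_group M" "abelian_group N" and f: "f \<in> linear_hom R M N" 
  shows "f \<zero>\<^bsub>M\<^esub> = \<zero>\<^bsub>N\<^esub>"
proof -
  interpret M: abelian_group M by fact
  interpret N: abelian_group N by fact
  have "f \<zero>\<^bsub>M\<^esub> \<oplus>\<^bsub>N\<^esub> f \<zero>\<^bsub>M\<^esub> = f \<zero>\<^bsub>M\<^esub>"
    using linear_hom_add[OF f, of "\<zero>\<^bsub>M\<^esub>" "\<zero>\<^bsub>M\<^esub>"] by simp
  then show ?thesis
    using linear_hom_closed[OF f] by (simp add: N.add.l_cancel_one')
qed

context simplicial_module
begin

lemma level_group: "abelian_group (M n)"
  using level_module module.axioms(2) by blast

text \<open>Subtracting \<open>S n l (D n r w \<ominus> y r)\<close> corrects the face \<open>r\<close>; it leaves the faces in \<open>J\<close> unchanged, because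
  there the compatibility of the horn makes \<open>D n r w \<ominus> y r\<close> have zero faces.\<close>

lemma horn_step:
  assumes w: "w \<in> carrier (M (Suc n))" and J: "J \<subseteq> {..Suc n}" and r: "r \<le> Suc n" "r = l \<or> r = Suc l" "l \<le> n"
    and y: "\<And>j. j \<in> insert r J \<Longrightarrow> y j \<in> carrier (M n)"
    and compat: "\<And>m i j. n = Suc m \<Longrightarrow> i < j \<Longrightarrow> i \<in> insert r J \<Longrightarrow> j \<in> insert r J \<Longrightarrow>
           D m i (y j) = D m (j - 1) (y i)"
    and Jl: "\<And>j. j \<in> J \<Longrightarrow> j < l \<or> Suc l < j"
    and wJ: "\<And>j. j \<in> J \<Longrightarrow> D n j w = y j"
  shows "\<exists>w' \<in> carrier (M (Suc n)). \<forall>j \<in> insert r J. D n j w' = y j"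
proof -
  interpret N: abelian_group "M n" by (rule level_group)
  interpret N1: abelian_group "M (Suc n)" by (rule level_group)
  define z where "z = D n r w \<ominus>\<^bsub>M n\<^esub> y r"
  define w' where "w' = w \<ominus>\<^bsub>M (Suc n)\<^esub> S n l z"
  have Dw: "D n r w \<in> carrier (M n)" using face_closed r(1) w by blast
  have yr: "y r \<in> carrier (M n)" using y by blast
  have z: "z \<in> carrier (M n)" using Dw yr by (simp add: z_def)
  have Sz: "S n l z \<in> carrier (M (Suc n))" using degen_closed r(3) z by blast
  have D_w': "D n j w' = D n j w \<ominus>\<^bsub>M n\<^esub> D n j (S n l z)" if "j \<le> Suc n" for j
    unfolding w'_def by (rule linear_hom_minus[OF level_group level_group face_linear[OF that] w Sz])
  have "D n r w' = y r"
  proof -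
    have "D n r w' = D n r w \<ominus>\<^bsub>M n\<^esub> z"
      using D_w'[OF r(1)] face_degen_id[OF r(2,3) z] by simp
    then show ?thesis
      using Dw yr by (simp add: z_def N.minus_eq N.minus_add N.r_neg2)
  qed
  moreover have "D n j w' = y j" if j: "j \<in> J" for j
  proof -
    have jn: "j \<le> Suc n" using j J by auto
    have jr: "j \<noteq> r" using Jl[OF j] r(2) by auto
    \<comment> \<open>A face outside \<open>l\<close> and \<open>l + 1\<close> exists only in
      positive degree: for \<open>n = 0\<close> it would have to be below 0, or both above 1 and at
      most 1.\<close>
    obtain m where m: "n = Suc m"
      using Jl[OF j] jn r(3) by (cases n) auto
    interpret N': abelian_group "M m" by (rule level_group)
    have zero: "D m i z = \<zero>\<^bsub>M m\<^esub>" if i: "i \<le> Suc m" "D m i (D n r w) = D m i (y r)" for i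
    proof -
      have "D m i z = D m i (D n r w) \<ominus>\<^bsub>M m\<^esub> D m i (y r)"
        using linear_hom_minus[OF level_group level_group face_linear[OF i(1)]] Dw yr m by (simp add: z_def)
      moreover have "D m i (y r) \<in> carrier (M m)" using face_closed i(1) yr m by blast
      ultimately show ?thesis using i(2) by (simp add: N'.r_neg N'.minus_eq)
    qed
    have S0: "S m k \<zero>\<^bsub>M m\<^esub> = \<zero>\<^bsub>M n\<^esub>" if "k \<le> m" for k
      using linear_hom_zero[OF level_group level_group degen_linear[OF that]] m by simp
    \<comment> \<open>Moving the face past the degeneracy produces a degeneracy of
      \<open>D m j z\<close> if \<open>j < l\<close>, and of \<open>D m (j - 1) z\<close> if
      \<open>j\<close> exceeds \<open>l + 1\<close>; the horn makes that face of \<open>z\<close>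
      zero.\<close>
    have "D n j (S n l z) = \<zero>\<^bsub>M n\<^esub>"
    proof (cases "j < l")
      case True
      have "D m j (D n r w) = D m j (y r)"
      proof -
        have "j < r" using True r(2) by auto
        then have "D m j (D n r w) = D m (r - 1) (D n j w)"
          using face_face[of j r m w] r(1) w m by simp
        also have "\<dots> = D m (r - 1) (y j)" using wJ[OF j] by simp
        also have "\<dots> = D m j (y r)" using compat[OF m \<open>j < r\<close>] j by simp
        finally show ?thesis .
      qed
      then have "D m j z = \<zero>\<^bsub>M m\<^esub>" using True r(3) m by (intro zero) auto
      then show ?thesis
        using face_degen_less[OF True, of m z] r(3) z m S0[of "l - 1"] by auto
    next
      case False
      then have lj: "Suc l < j" using Jl[OF j] by blast
      then have rj: "r < j" using r(2) by auto
      have "D m (j - 1) (D n r w) = D m (j - 1) (y r)"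
      proof -
        have "D m (j - 1) (D n r w) = D m r (D n j w)"
          using face_face[of r j m w] rj jn w m by simp
        also have "\<dots> = D m r (y j)" using wJ[OF j] by simp
        also have "\<dots> = D m (j - 1) (y r)" using compat[OF m rj] j by simp
        finally show ?thesis .
      qed
      then have "D m (j - 1) z = \<zero>\<^bsub>M m\<^esub>" using jn m by (intro zero) auto
      then show ?thesis
        using face_degen_greater[OF lj, of m z] jn lj z m S0[of l] by auto
    qed
    then show ?thesis
      using D_w'[OF jn] wJ[OF j] y j by (simp add: N.minus_eq)
  qed
  moreover have "w' \<in> carrier (M (Suc n))" using w Sz by (simp add: w'_def)
  ultimately show ?thesis by blast
qed

text \<open>Moore's argument: fill the faces below \<open>k\<close> in increasing order, then those above \<open>k\<close> in
  decreasing order.\<close>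

theorem kan_simplicial_module: "kan (\<lambda>n. carrier (M n)) D"
  unfolding kan_def
proof (intro allI impI)
  fix n k y
  assume k: "k \<le> Suc n" and horn: "(\<forall>j\<in>{..Suc n} - {k}. y j \<in> carrier (M n)) \<and>
    (\<forall>m i j. n = Suc m \<and> i < j \<and> i \<in> {..Suc n} - {k} \<and> j \<in> {..Suc n} - {k} \<longrightarrow>
       D m i (y j) = D m (j - 1) (y i))"
  interpret N1: abelian_group "M (Suc n)" by (rule level_group)
  have y: "\<And>j. j \<in> {..Suc n} - {k} \<Longrightarrow> y j \<in> carrier (M n)" using horn by blast
  have compat: "\<And>m i j. n = Suc m \<Longrightarrow> i < j \<Longrightarrow> i \<in> {..Suc n} - {k} \<Longrightarrow> j \<in> {..Suc n} - {k} \<Longrightarrow>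
    D m i (y j) = D m (j - 1) (y i)" using horn by blast
  have low: "\<exists>w\<in>carrier (M (Suc n)). \<forall>j\<in>{..<r}. D n j w = y j" if "r \<le> k" for r
    using that
  proof (induction r)
    case (Suc r)
    then obtain w where w: "w \<in> carrier (M (Suc n))" "\<forall>j\<in>{..<r}. D n j w = y j" by auto
    \<comment> \<open>With \<open>l = r\<close> the correction also disturbs face
      \<open>r + 1\<close>, which is the missing face or still to be repaired. The faces below
      \<open>r\<close> are kept.\<close>
    have "\<exists>w\<in>carrier (M (Suc n)). \<forall>j\<in>insert r {..<r}. D n j w = y j"
      using w Suc.prems k y compat by (intro horn_step[OF w(1), where l = r]) auto
    then show ?case by (simp add: lessThan_Suc)
  qed auto
  \<comment> \<open>Here \<open>i\<close> counts the faces already repaired from the top.\<close>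
  have high: "\<exists>w\<in>carrier (M (Suc n)). \<forall>j\<in>{..<k} \<union> {Suc n - i<..Suc n}. D n j w = y j" if "i \<le> Suc n - k" for i
    using that
  proof (induction i)
    case 0
    then show ?case using low[of k] by simp
  next
    case (Suc i)
    let ?J = "{..<k} \<union> {Suc n - i<..Suc n}" and ?r = "Suc n - i"
    obtain w where w: "w \<in> carrier (M (Suc n))" "\<forall>j\<in>?J. D n j w = y j" using Suc by auto
    have "\<exists>w\<in>carrier (M (Suc n)). \<forall>j\<in>insert ?r ?J. D n j w = y j"
    \<comment> \<open>Now \<open>?r\<close> is \<open>l + 1\<close>, so the other disturbed face is
      the one just below \<open>?r\<close>: the missing face or one still to be repaired. The bound
      on \<open>i\<close> gives \<open>k \<le> l\<close>, which protects the faces below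
      \<open>k\<close>.\<close>
    proof (rule horn_step[OF w(1), where l = "n - i"])
      have J: "insert ?r ?J \<subseteq> {..Suc n} - {k}" using Suc.prems by auto
      show "y j \<in> carrier (M n)" if "j \<in> insert ?r ?J" for j
        using y[OF subsetD[OF J that]] .
      show "D m i' (y j) = D m (j - 1) (y i')"
        if "n = Suc m" "i' < j" "i' \<in> insert ?r ?J" "j \<in> insert ?r ?J" for m i' j
        using compat[OF that(1,2) subsetD[OF J that(3)] subsetD[OF J that(4)]] .
      show "?J \<subseteq> {..Suc n}" using J by blast
    qed (use w Suc.prems in auto)
    moreover have "{..<k} \<union> {Suc n - Suc i<..Suc n} = insert ?r ?J"
      using Suc.prems by auto
    ultimately show ?case by (simp only:)
  qed
  have "{..<k} \<union> {Suc n - (Suc n - k)<..Suc n} = {..Suc n} - {k}"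
    using k by auto
  then show "\<exists>x\<in>carrier (M (Suc n)). \<forall>j\<in>{..Suc n} - {k}. D n j x = y j"
    using high[of "Suc n - k"] by simp
qed

end

section \<open>The simplicial set and the category of traces\<close>

lemma continuous_map_simplical_face:
  assumes "j \<le> Suc n"
  shows "continuous_map (simplex_top n) (simplex_top (Suc n)) (simplical_face j)"
proof -
  have "continuous_map (powertop_real UNIV) euclideanreal (\<lambda>x. simplical_face j x i)" for i
    unfolding simplical_face_def by (auto intro: continuous_map_product_projection)
  then have "continuous_map (simplex_top n) (powertop_real UNIV) (simplical_face j)"
    by (auto simp: continuous_map_componentwise_UNIV intro: continuous_map_from_subtopology)
  moreover have "simplical_face j x \<in> standard_simplex (Suc n)" if "x \<in> standard_simplex n" for x :: "nat \<Rightarrow> real"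
    using simplical_face_in_standard_simplex[of "Suc n" j x] assms that by simp
  ultimately show ?thesis
    by (auto simp: continuous_map_in_subtopology)
qed

text \<open>The induction starts at \<open>n = k\<close>, where the merged coordinate is the last
  one; every later coordinate is merely shifted.\<close>

lemma sum_simplicial_degeneracy:
  assumes "k \<le> n"
  shows "(\<Sum>i\<le>n. simplicial_degeneracy k t i) = (\<Sum>i\<le>Suc n. t i)"
  using assms
proof (induction n rule: nat_induct_at_least)
  case base
  have "(\<Sum>i<k. simplicial_degeneracy k t i) = (\<Sum>i<k. t i)"
    by (intro sum.cong) (auto simp: simplicial_degeneracy_def)
  then show ?case
    by (simp add: simplicial_degeneracy_def flip: lessThan_Suc_atMost)
next
  case (Suc n)
  then show ?case by (simp add: simplicial_degeneracy_def)
qed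

lemma simplicial_degeneracy_in_standard_simplex:
  assumes k: "k \<le> n" and t: "t \<in> standard_simplex (Suc n)"
  shows "simplicial_degeneracy k t \<in> standard_simplex n"
proof -
  let ?u = "simplicial_degeneracy k t"
  have 0: "0 \<le> ?u i" for i using t by (auto simp: standard_simplex_def simplicial_degeneracy_def)
  have van: "?u i = 0" if "i > n" for i
    using t k that by (auto simp: standard_simplex_def simplicial_degeneracy_def)
  have sum: "(\<Sum>i\<le>n. ?u i) = 1"
    using t by (simp only: sum_simplicial_degeneracy[OF k] standard_simplex_def mem_Collect_eq)
  \<comment> \<open>\<open>standard_simplex\<close> also bounds each coordinate by 1. Within range
    this follows because a nonnegative summand is at most the total.\<close>
  have "?u i \<le> 1" for i
  proof (cases "i \<le> n")
    case True
    then have "?u i \<le> (\<Sum>i\<le>n. ?u i)" using 0 by (intro member_le_sum) auto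
    then show ?thesis by (simp add: sum)
  qed (use van in auto)
  then show ?thesis using 0 van sum by (auto simp: standard_simplex_def)
qed

lemma continuous_map_simplicial_degeneracy:
  assumes "k \<le> n"
  shows "continuous_map (simplex_top (Suc n)) (simplex_top n) (simplicial_degeneracy k)"
proof -
  have "continuous_map (powertop_real UNIV) euclideanreal (\<lambda>x. simplicial_degeneracy k x i)" for i
    unfolding simplicial_degeneracy_def 
    by (auto intro!: continuous_map_product_projection continuous_map_add)
  then have "continuous_map (simplex_top (Suc n)) (powertop_real UNIV) (simplicial_degeneracy k)"
    by (auto simp: continuous_map_componentwise_UNIV intro: continuous_map_from_subtopology)
  then show ?thesis
    using simplicial_degeneracy_in_standard_simplex[OF assms]
    by (auto simp: continuous_map_in_subtopology)
qed

text \<open>This and the next lemmas are the cosimplicial identities. Composites appear in the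
  reverse of the simplicial order because pulling back is contravariant.\<close>

lemma simplical_face_face:
  fixes t :: "nat \<Rightarrow> real"
  assumes "i < j"
  shows "simplical_face j (simplical_face i t) = simplical_face i (simplical_face (j - 1) t)"
  using assms by (auto simp: simplical_face_def fun_eq_iff)

lemma simplicial_degeneracy_degeneracy:
  assumes "i \<le> j"
  shows "simplicial_degeneracy j (simplicial_degeneracy i t) =
    simplicial_degeneracy i (simplicial_degeneracy (Suc j) t)"
  using assms by (auto simp: simplicial_degeneracy_def fun_eq_iff not_less less_Suc_eq le_less)

lemma simplicial_degeneracy_face_less:
  assumes "i < j"
  shows "simplicial_degeneracy j (simplical_face i t) = simplical_face i (simplicial_degeneracy (j - 1) t)"
proof
  fix x
  obtain j' where j: "j = Suc j'" using assms by (cases j) auto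
  show "simplicial_degeneracy j (simplical_face i t) x = simplical_face i (simplicial_degeneracy (j - 1) t) x"
    using assms by (cases x) (auto simp: j simplical_face_def simplicial_degeneracy_def)
qed

lemma simplicial_degeneracy_face_id:
  assumes "i = j \<or> i = Suc j"
  shows "simplicial_degeneracy j (simplical_face i t) = t"
  using assms by (auto simp: simplical_face_def simplicial_degeneracy_def fun_eq_iff)

lemma simplicial_degeneracy_face_greater:
  assumes "Suc j < i"
  shows "simplicial_degeneracy j (simplical_face i t) = simplical_face (i - 1) (simplicial_degeneracy j t)"
proof
  fix x
  show "simplicial_degeneracy j (simplical_face i t) x = simplical_face (i - 1) (simplicial_degeneracy j t) x"
    using assms by (cases x) (auto simp: simplical_face_def simplicial_degeneracy_def)
qed

text \<open>The index sets \<open>A\<close> and \<open>B\<close> cover two uses at once: the basis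
  of the full algebra when both are \<open>topspace X\<close>, and the traces between fixed points
  when both are singletons.\<close>

lemma simplicial_set_traces:
  assumes X: "d_space X dX"
  shows "simplicial_set (\<lambda>n. \<Union>a\<in>A. \<Union>b\<in>B. traces X dX (Suc n) a b)
    (\<lambda>n. trace_face X dX (Suc n)) (\<lambda>n. trace_degen X dX (Suc n))"
proof -
  note pull = trace_face_eq_pull trace_degen_eq_pull
  note cont = continuous_map_simplical_face continuous_map_simplicial_degeneracy
  note closed = trace_pull_in_traces[OF X]
  note pp = trace_pull_pull[OF X]
  show ?thesis
    unfolding pull
  proof (unfold_locales, goal_cases)
    case (1 j n \<tau>) then show ?case by (auto intro!: closed cont)
  next
    case (2 k n \<tau>) then show ?case by (auto intro!: closed cont)
  next
    case (3 i j n \<tau>)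
    then obtain a b where "\<tau> \<in> traces X dX (Suc (Suc (Suc n))) a b" by blast
    note pp = pp[OF this]
    show ?case
      using 3 by (simp add: pp[OF cont(1) cont(1)] simplical_face_face)
  next
    case (4 i j n \<tau>)
    then obtain a b where "\<tau> \<in> traces X dX (Suc n) a b" by blast
    note pp = pp[OF this]
    show ?case
      using 4 by (simp add: pp[OF cont(2) cont(2)] simplicial_degeneracy_degeneracy)
  next
    case (5 i j n \<tau>)
    then obtain a b where "\<tau> \<in> traces X dX (Suc (Suc n)) a b" by blast
    note pp = pp[OF this]
    show ?case
      using 5 by (simp add: pp[OF cont(1) cont(2)] pp[OF cont(2) cont(1)] simplicial_degeneracy_face_less)
  next
    case (6 i j n \<tau>)
    then obtain a b where \<tau>: "\<tau> \<in> traces X dX (Suc n) a b" by blast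
    note pp = pp[OF this]
    have "i \<le> Suc n" using 6 by auto
    then show ?case
      using 6 by (simp add: pp[OF cont(2) cont(1)] simplicial_degeneracy_face_id trace_pull_id[OF X \<tau>])
  next
    case (7 j i n \<tau>)
    then obtain a b where "\<tau> \<in> traces X dX (Suc (Suc n)) a b" by blast
    note pp = pp[OF this]
    show ?case
      using 7 by (simp add: pp[OF cont(1) cont(2)] pp[OF cont(2) cont(1)] simplicial_degeneracy_face_greater)
  qed
qed

text \<open>Associativity and both unit laws fail for paths but hold for traces, each by a single
  change of parameter.\<close>

lemma linear_category_traces:
  assumes R: "cring R" and X: "d_space X dX"
  shows "linear_category R (topspace X) (traces X dX (Suc n)) (trace_concat X dX (Suc n))
    (const_trace X dX (Suc n))"
proof (intro linear_category.intro linear_category_axioms.intro R)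
  note concat = trace_concat_trace_of[OF X] ipath_concat_in_between[OF X]
  fix a b a' b' c d p q r
  show "a = a' \<and> b = b'" if p: "p \<in> traces X dX (Suc n) a b" "p \<in> traces X dX (Suc n) a' b'"
  proof -
    obtain u where u: "u \<in> ipaths_between X dX (Suc n) a b" "p = trace_of X dX (Suc n) u"
      using p(1) by (rule tracesE)
    obtain v where v: "v \<in> ipaths_between X dX (Suc n) a' b'" "p = trace_of X dX (Suc n) v"
      using p(2) by (rule tracesE)
    have "u \<in> ipaths_between X dX (Suc n) a' b'"
      using trace_of_between[OF X v(1)] self_in_trace_of u(2) v(2) by metis
    then show ?thesis using ipaths_between_endpoints u(1) by metis
  qed
  show "trace_concat X dX (Suc n) p q \<in> traces X dX (Suc n) a c"
    if "p \<in> traces X dX (Suc n) a b" "q \<in> traces X dX (Suc n) b c"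
    using that by (elim tracesE) (auto simp: concat traces_def)
  show "trace_concat X dX (Suc n) (trace_concat X dX (Suc n) p q) r =
      trace_concat X dX (Suc n) p (trace_concat X dX (Suc n) q r)"
    if p: "p \<in> traces X dX (Suc n) a b" and q: "q \<in> traces X dX (Suc n) b c" and r: "r \<in> traces X dX (Suc n) c d"
  proof -
    obtain u where u: "u \<in> ipaths_between X dX (Suc n) a b" "p = trace_of X dX (Suc n) u"
      using p by (rule tracesE)
    obtain v where v: "v \<in> ipaths_between X dX (Suc n) b c" "q = trace_of X dX (Suc n) v"
      using q by (rule tracesE)
    obtain w where w: "w \<in> ipaths_between X dX (Suc n) c d" "r = trace_of X dX (Suc n) w"
      using r by (rule tracesE)
    show ?thesis
      unfolding u(2) v(2) w(2) concat(1)[OF u(1) v(1)] concat(1)[OF v(1) w(1)]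
        concat(1)[OF concat(2)[OF u(1) v(1)] w(1)] concat(1)[OF u(1) concat(2)[OF v(1) w(1)]]
      by (rule trace_of_eqI[OF ipath_reparam_concat_assoc[OF X u(1) v(1) w(1)]])
  qed
  show "const_trace X dX (Suc n) a \<in> traces X dX (Suc n) a a" if "a \<in> topspace X"
    using const_in_ipaths_between[OF X that] by (auto simp: const_trace_def traces_def)
  show "trace_concat X dX (Suc n) (const_trace X dX (Suc n) a) p = p"
    if a: "a \<in> topspace X" and p: "p \<in> traces X dX (Suc n) a b"
  proof -
    obtain u where u: "u \<in> ipaths_between X dX (Suc n) a b" "p = trace_of X dX (Suc n) u"
      using p by (rule tracesE)
    show ?thesis
      unfolding u(2) const_trace_def concat(1)[OF const_in_ipaths_between[OF X a] u(1)]
      by (rule trace_of_eqI[OF ipath_reparam_const_left[OF u(1)], symmetric])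
  qed
  show "trace_concat X dX (Suc n) p (const_trace X dX (Suc n) b) = p"
    if b: "b \<in> topspace X" and p: "p \<in> traces X dX (Suc n) a b"
  proof -
    obtain u where u: "u \<in> ipaths_between X dX (Suc n) a b" "p = trace_of X dX (Suc n) u"
      using p by (rule tracesE)
    show ?thesis
      unfolding u(2) const_trace_def concat(1)[OF u(1) const_in_ipaths_between[OF X b]]
      by (rule trace_of_eqI[OF ipath_reparam_const_right[OF u(1)], symmetric])
  qed
qed

section \<open>Freeness of the corners and assembly of the theorem\<close>

text \<open>The isomorphism with the model is the identity map: the two sides differ only in the
  product field.\<close>

lemma is_free_simplicial_module_linear_extension:
  assumes R: "cring R" and K: "simplicial_set K d s"
  shows "is_free_simplicial_module R (\<lambda>n. (free_module R (K n))\<lparr>mult := m n\<rparr>)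
    (\<lambda>n j. linear_extension R (d n j)) (\<lambda>n k. linear_extension R (s n k)) K d s (\<lambda>n. basis_elem R)"
proof -
  \<comment> \<open>The model is itself an instance of a free module with replaced product, since
    its field \<open>mult\<close> is \<open>undefined\<close>.\<close>
  have "(free_module R (K n))\<lparr>mult := undefined\<rparr> = free_module R (K n)" for n
    by (simp add: free_module_def)
  then have "simplicial_module R (\<lambda>n. free_module R (K n))
      (\<lambda>n j. linear_extension R (d n j)) (\<lambda>n k. linear_extension R (s n k))"
    using cring.simplicial_module_linear_extension[OF R K, of "\<lambda>n. undefined"] by (simp only:)
  moreover have "(\<lambda>f. f) \<in> linear_hom R (free_module R (K n)) ((free_module R (K n))\<lparr>mult := m n\<rparr>)" for n
    by (simp add: linear_hom_def free_module_def)
  ultimately have "simplicial_module_iso R (\<lambda>n. free_module R (K n))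
      (\<lambda>n j. linear_extension R (d n j)) (\<lambda>n k. linear_extension R (s n k))
      (\<lambda>n. (free_module R (K n))\<lparr>mult := m n\<rparr>)
      (\<lambda>n j. linear_extension R (d n j)) (\<lambda>n k. linear_extension R (s n k)) (\<lambda>n f. f)"
    using cring.simplicial_module_linear_extension[OF R K, of m]
    by (simp add: simplicial_module_iso_def bij_betw_def)
  then show ?thesis
    unfolding is_free_simplicial_module_def using K by blast
qed

theorem theorem1:
  fixes R :: "('r, 'z) ring_scheme" and X :: "'a topology" and dX :: "(real \<Rightarrow> 'a) set"
  assumes "cring R" and "d_space X dX"
  shows "\<exists>D S.
    simplicial_algebra R (\<lambda>n. trace_algebra R X dX (Suc n)) D S \<and>
    kan (\<lambda>n. carrier (trace_algebra R X dX (Suc n))) D \<and>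
    (\<forall>a \<in> topspace X. \<forall>b \<in> topspace X.
       simplicial_module R (\<lambda>n. trace_module R X dX (Suc n) a b) D S \<and>
       kan (\<lambda>n. carrier (trace_module R X dX (Suc n) a b)) D \<and>
       is_free_simplicial_module R (\<lambda>n. trace_module R X dX (Suc n) a b) D S
         (\<lambda>n. traces X dX (Suc n) a b)
         (\<lambda>n. trace_face X dX (Suc n)) (\<lambda>n. trace_degen X dX (Suc n))
         (\<lambda>n. basis_elem R))"
proof -
  note R = assms(1) and X = assms(2)
  let ?C = "\<lambda>n. linear_category R (topspace X) (traces X dX (Suc n)) (trace_concat X dX (Suc n)) (const_trace X dX (Suc n))"
  have C: "?C n" for n by (rule linear_category_traces[OF R X])
  define K where "K n = (\<Union>a \<in> topspace X. \<Union>b \<in> topspace X. traces X dX (Suc n) a b)" for n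
  define m where "m n = linear_category.conv R (topspace X) (traces X dX (Suc n)) (trace_concat X dX (Suc n))" for n
  \<comment> \<open>Linear extension does not mention the basis, and elements vanish outside it. The
    same \<open>D\<close> and \<open>S\<close> therefore serve the algebras and all corners, and
    restricting the structure changes nothing but the carriers.\<close>
  define D where "D n j = linear_extension R (trace_face X dX (Suc n) j)" for n j
  define S where "S n k = linear_extension R (trace_degen X dX (Suc n) k)" for n k
  have D_eq: "D = (\<lambda>n j. linear_extension R (trace_face X dX (Suc n) j))"
    and S_eq: "S = (\<lambda>n k. linear_extension R (trace_degen X dX (Suc n) k))"
    by (simp_all add: fun_eq_iff D_def S_def)
  have alg: "trace_algebra R X dX (Suc n) = (free_module R (K n))\<lparr>mult := m n\<rparr>" for n
    unfolding trace_algebra_def K_def m_def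
    using linear_category.category_algebra_eq[OF C] linear_category.Mor_def[OF C] by simp
  have K: "simplicial_set K (\<lambda>n. trace_face X dX (Suc n)) (\<lambda>n. trace_degen X dX (Suc n))"
    using simplicial_set_traces[OF X, of "topspace X" "topspace X"] by (simp add: K_def[abs_def])
  have alg_module: "simplicial_module R (\<lambda>n. trace_algebra R X dX (Suc n)) D S"
    unfolding alg D_eq S_eq by (rule cring.simplicial_module_linear_extension[OF R K])
  \<comment> \<open>Stated for an arbitrary continuous map of simplices, so that faces and
    degeneracies are instances.\<close>
  have hom: "linear_extension R (trace_pull X dX (Suc l) \<sigma>) \<in>
      algebra_hom R (trace_algebra R X dX (Suc n)) (trace_algebra R X dX (Suc l))"
    if \<sigma>: "continuous_map (simplex_top l) (simplex_top n) \<sigma>" for l n \<sigma>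
    unfolding trace_algebra_def
    by (rule linear_extension_algebra_hom[OF C C]) (use trace_pull_in_traces[OF X _ \<sigma>] trace_pull_concat[OF X _ _ \<sigma>] in auto)
  have "simplicial_algebra R (\<lambda>n. trace_algebra R X dX (Suc n)) D S"
  proof (intro simplicial_algebra.intro simplicial_algebra_axioms.intro)
    show "simplicial_set (\<lambda>n. carrier (trace_algebra R X dX (Suc n))) D S"
      using alg_module by (rule simplicial_module.axioms(1))
    show "nonunital_algebra R (trace_algebra R X dX (Suc n))" for n
      unfolding trace_algebra_def by (rule linear_category.nonunital_algebra_category_algebra[OF C])
    show "D n j \<in> algebra_hom R (trace_algebra R X dX (Suc (Suc n))) (trace_algebra R X dX (Suc n))"
      if "j \<le> Suc n" for n j
      unfolding D_def trace_face_eq_pull by (rule hom[OF continuous_map_simplical_face[OF that]])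
    show "S n k \<in> algebra_hom R (trace_algebra R X dX (Suc n)) (trace_algebra R X dX (Suc (Suc n)))"
      if "k \<le> n" for n k
      unfolding S_def trace_degen_eq_pull by (rule hom[OF continuous_map_simplicial_degeneracy[OF that]])
  qed
  moreover have "kan (\<lambda>n. carrier (trace_algebra R X dX (Suc n))) D"
    by (rule simplicial_module.kan_simplicial_module[OF alg_module])
  moreover have "simplicial_module R (\<lambda>n. trace_module R X dX (Suc n) a b) D S \<and>
       kan (\<lambda>n. carrier (trace_module R X dX (Suc n) a b)) D \<and>
       is_free_simplicial_module R (\<lambda>n. trace_module R X dX (Suc n) a b) D S
         (\<lambda>n. traces X dX (Suc n) a b)
         (\<lambda>n. trace_face X dX (Suc n)) (\<lambda>n. trace_degen X dX (Suc n))
         (\<lambda>n. basis_elem R)"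
    if a: "a \<in> topspace X" and b: "b \<in> topspace X" for a b
  proof -
    have corner: "trace_module R X dX (Suc n) a b = (free_module R (traces X dX (Suc n) a b))\<lparr>mult := m n\<rparr>" for n
      unfolding trace_module_def trace_algebra_def m_def
      by (rule linear_category.corner_category_algebra[OF C a b])
    have K: "simplicial_set (\<lambda>n. traces X dX (Suc n) a b)
        (\<lambda>n. trace_face X dX (Suc n)) (\<lambda>n. trace_degen X dX (Suc n))"
      using simplicial_set_traces[OF X, where A = "{a}" and B = "{b}"] by simp
    have mod: "simplicial_module R (\<lambda>n. trace_module R X dX (Suc n) a b) D S"
      unfolding corner D_eq S_eq by (rule cring.simplicial_module_linear_extension[OF R K])
    moreover have "kan (\<lambda>n. carrier (trace_module R X dX (Suc n) a b)) D"
      by (rule simplicial_module.kan_simplicial_module[OF mod])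
    moreover have "is_free_simplicial_module R (\<lambda>n. trace_module R X dX (Suc n) a b) D S
         (\<lambda>n. traces X dX (Suc n) a b)
         (\<lambda>n. trace_face X dX (Suc n)) (\<lambda>n. trace_degen X dX (Suc n))
         (\<lambda>n. basis_elem R)"
      unfolding corner D_eq S_eq by (rule is_free_simplicial_module_linear_extension[OF R K])
    ultimately show ?thesis by blast
  qed
  ultimately show ?thesis by blast
qed

end
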